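(* Let $s\in(0,1)$, $n>2s$, and let $\Omega\subset\mathbb{R}^n$ be an open bounded set with Lipschitz boundary. Let $f:[0,+\infty)\to[0,+\infty)$ be a continuous function, and put $F(\xi):=\int_0^\xi f(t)\,dt$ for $\xi\ge 0$. Assume that for some $q\in\left[1,\frac{2n}{n-2s}\right)$ the function $t\mapsto \frac{f(t)}{t^{q-1}}$ is strictly decreasing in $(0,+\infty)$ and $\lim_{t\to+\infty}\frac{f(t)}{t^{q-1}}=0$. Suppose further that $$\lim_{\xi\to+\infty}\frac{F(\xi)}{\xi^2}=0\quad\text{and}\quad \liminf_{\xi\to0^+}\frac{F(\xi)}{\xi^2}>0.$$ Then, for every $$\alpha>\frac{\lambda_{1,s}}{2\,\liminf_{\xi\to0^+}\frac{F(\xi)}{\xi^2}},$$ the problem $$(-\Delta)^s u=\alpha f(u)\ \text{ in }\Omega,\qquad u=0\ \text{ in }\mathbb{R}^n\setminus\Omega,$$ admits at least one non-negative and non-zero weak solution $u_\alpha\in H^s(\mathbb{R}^n)$ such that $u_\alpha=0$ a.e. in $\mathbb{R}^n\setminus\Omega$.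
   Context: $H^s(\mathbb{R}^n)$ is the usual fractional Sobolev space, with norm $\|g\|_{L^2(\mathbb{R}^n)}+\big(\int_{\mathbb{R}^n\times\mathbb{R}^n}\frac{|g(x)-g(y)|^2}{|x-y|^{n+2s}}\,dx\,dy\big)^{1/2}$. Let $X_0:=\{g\in H^s(\mathbb{R}^n): g=0 \text{ a.e. in }\mathbb{R}^n\setminus\Omega\}$. The fractional Laplacian is normalized by $$-(-\Delta)^s u(x)=\int_{\mathbb{R}^n}\frac{u(x+y)+u(x-y)-2u(x)}{|y|^{n+2s}}\,dy .$$ A (non-negative) weak solution of the problem $(-\Delta)^s u=\alpha f(u)$ in $\Omega$, $u=0$ in $\mathbb{R}^n\setminus\Omega$, is a function $u\in X_0$, $u\ge 0$ a.e., such that $$\int_{\mathbb{R}^n\times\mathbb{R}^n}\frac{(u(x)-u(y))(\varphi(x)-\varphi(y))}{|x-y|^{n+2s}}\,dx\,dy=\alpha\int_\Omega f(u(x))\varphi(x)\,dx\qquad\text{for every }\varphi\in X_0.$$ $\lambda_{1,s}$ is the first eigenvalue of $(-\Delta)^s u=\lambda u$ in $\Omega$, $u=0$ in $\mathbb{R}^n\setminus\Omega$, i.e. $$\lambda_{1,s}=\min_{u\in X_0\setminus\{0\}}\frac{\int_{\mathbb{R}^{n}\times\mathbb{R}^n}\frac{|u(x)-u(y)|^2}{|x-y|^{n+2s}}\,dx\,dy}{\int_\Omega u(x)^2\,dx}.$$ Convention: if $\liminf_{\xi\to0^+}F(\xi)/\xi^2=+\infty$, the quotient $\lambda_{1,s}/(2\liminf_{\xi\to0^+}F(\xi)/\xi^2)$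 is understood as $0$. *)

theory Defs
  imports "HOL-Analysis.Analysis"
begin

text \<open>
  Elements of \<open>L\<^sup>2(\<real>\<^sup>n)\<close> and \<open>H\<^sup>s(\<real>\<^sup>n)\<close> are represented by Lebesgue measurable functions; equality
  in these spaces is equality almost everywhere. The dimension \<open>n\<close> is \<open>CARD('n)\<close>, and
  \<open>\<real>\<^sup>n \<times> \<real>\<^sup>n\<close> is the Euclidean space \<open>(real ^ 'n) \<times> (real ^ 'n)\<close> with its Lebesgue measure.
\<close>

text \<open>
  \<open>\<Omega>\<close> is, near each boundary point, the strict epigraph of a Lipschitz function in some orthonormal
  coordinate system. The unit vector \<open>e\<close> is the direction of the last axis of that system: \<open>x \<bullet> e\<close>
  is the last coordinate of \<open>x\<close>, and \<open>x - (x \<bullet> e) *\<^sub>R e\<close> in the hyperplane \<open>e\<^sup>\<bottom>\<close>, identified with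
  \<open>\<real>\<^sup>n\<^sup>-\<^sup>1\<close>, collects the others. For \<open>n = 1\<close> that hyperplane is \<open>{0}\<close>.
\<close>
definition lipschitz_boundary :: "(real ^ 'n) set \<Rightarrow> bool" where
  "lipschitz_boundary \<Omega> \<longleftrightarrow>
     (\<forall>p \<in> frontier \<Omega>. \<exists>r > 0. \<exists>e \<gamma> L. norm e = 1 \<and>
        L-lipschitz_on {z. z \<bullet> e = 0} \<gamma> \<and>
        \<Omega> \<inter> ball p r = {x \<in> ball p r. \<gamma> (x - (x \<bullet> e) *\<^sub>R e) < x \<bullet> e})"

text \<open>
  On the diagonal \<open>x = y\<close>, a null set, the integrand is \<open>0 / 0 = 0\<close>.
\<close>
definition gagliardo_integrand ::
    "real \<Rightarrow> (real ^ 'n \<Rightarrow> real) \<Rightarrow> (real ^ 'n \<Rightarrow> real) \<Rightarrow> (real ^ 'n) \<times> (real ^ 'n) \<Rightarrow> real" where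
  "gagliardo_integrand s u v =
     (\<lambda>(x, y). (u x - u y) * (v x - v y) / norm (x - y) powr (real CARD('n) + 2 * s))"

definition gagliardo_form :: "real \<Rightarrow> (real ^ 'n \<Rightarrow> real) \<Rightarrow> (real ^ 'n \<Rightarrow> real) \<Rightarrow> real" where
  "gagliardo_form s u v = (LINT z|lebesgue. gagliardo_integrand s u v z)"

definition sobolev_space :: "real \<Rightarrow> (real ^ 'n \<Rightarrow> real) set" where
  "sobolev_space s = {g \<in> borel_measurable lebesgue.
     integrable lebesgue (\<lambda>x. (g x)\<^sup>2) \<and> integrable lebesgue (gagliardo_integrand s g g)}"

definition X0 :: "real \<Rightarrow> (real ^ 'n) set \<Rightarrow> (real ^ 'n \<Rightarrow> real) set" where
  "X0 s \<Omega> = {g \<in> sobolev_space s. AE x in lebesgue. x \<notin> \<Omega> \<longrightarrow> g x = 0}"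

text \<open>
  \<open>LEAST\<close> is the minimum, not merely the infimum, of the set of Rayleigh quotients.
\<close>
definition first_eigenvalue :: "real \<Rightarrow> (real ^ 'n) set \<Rightarrow> real" where
  "first_eigenvalue s \<Omega> = (LEAST l. l \<in>
     {gagliardo_form s u u / (LINT x:\<Omega>|lebesgue. (u x)\<^sup>2) | u.
        u \<in> X0 s \<Omega> \<and> \<not> (AE x in lebesgue. u x = 0)})"

text \<open>
  Non-negative weak solutions of \<open>(-\<Delta>)\<^sup>s u = \<alpha> f(u)\<close> in \<open>\<Omega>\<close>, \<open>u = 0\<close> in \<open>\<real>\<^sup>n - \<Omega>\<close>. Only the values of
  \<open>f\<close> on \<open>{0..}\<close> matter, since \<open>u \<ge> 0\<close> almost everywhere. The Bochner integral of a non-integrable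
  function is \<open>0\<close> by convention, so integrability of the right-hand side is required explicitly.
  No constant multiplies the double integral: it is the form of the operator normalized by
  \<open>-(-\<Delta>)\<^sup>s u(x) = \<integral> (u(x+y) + u(x-y) - 2 u(x)) / |y| powr (n + 2 s) dy\<close>.
\<close>
definition nonneg_weak_solution ::
    "real \<Rightarrow> (real ^ 'n) set \<Rightarrow> real \<Rightarrow> (real \<Rightarrow> real) \<Rightarrow> (real ^ 'n \<Rightarrow> real) \<Rightarrow> bool" where
  "nonneg_weak_solution s \<Omega> \<alpha> f u \<longleftrightarrow>
     u \<in> X0 s \<Omega> \<and> (AE x in lebesgue. 0 \<le> u x) \<and>
     (\<forall>\<phi> \<in> X0 s \<Omega>.
        set_integrable lebesgue \<Omega> (\<lambda>x. f (u x) * \<phi> x) \<and>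
        gagliardo_form s u \<phi> = \<alpha> * (LINT x:\<Omega>|lebesgue. f (u x) * \<phi> x))"

definition primitive :: "(real \<Rightarrow> real) \<Rightarrow> real \<Rightarrow> real" where
  "primitive f \<xi> = integral {0..\<xi>} f"

text \<open>
  Extended-real valued, as the lower limit may be \<open>\<infinity>\<close>; note that \<open>c / \<infinity> = 0\<close> in \<open>ereal\<close>.
\<close>
definition liminf_quotient :: "(real \<Rightarrow> real) \<Rightarrow> ereal" where
  "liminf_quotient f = Liminf (at_right 0) (\<lambda>\<xi>. ereal (primitive f \<xi> / \<xi>\<^sup>2))"

end

theory Submission
  imports Defs "HOL-Complex_Analysis.Great_Picard"
begin

text \<open>
  The solution is a global minimiser of the functional
  \<open>J(u) = [u]\<^sup>2 / 2 - \<alpha> \<integral>\<^bsub>\<Omega>\<^esub> F(u)\<close> on the space of functions in \<open>H\<^sup>s\<close> that vanish off \<open>\<Omega>\<close>, where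
  \<open>[u]\<^sup>2\<close> is the Gagliardo double integral and \<open>F\<close> is a primitive of \<open>f\<close>, continued linearly with
  slope \<open>f(0)\<close> to the negative half-line so that it is continuously differentiable everywhere.

  Since \<open>f(t) / t powr (q - 1)\<close> decreases, the values of \<open>f\<close> on \<open>[\<xi> / 2, \<xi>]\<close> are at least a fixed
  multiple of \<open>f(\<xi>)\<close>, whence \<open>\<xi> f(\<xi>)\<close> is at most a constant times \<open>F(\<xi>)\<close>
  (\<open>decreasing_quotient_bound\<close>). As \<open>F(\<xi>) = o(\<xi>\<^sup>2)\<close> at infinity, \<open>f\<close> has at most linear growth
  (\<open>linear_growth\<close>), and \<open>L\<^sup>2\<close> convergence suffices to pass to the limit in \<open>\<integral>\<^bsub>\<Omega>\<^esub> F(u)\<close>.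
  The same decay of \<open>F\<close> and the Poincare inequality \<open>\<integral> u\<^sup>2 \<le> C [u]\<^sup>2\<close> make \<open>J\<close> coercive.

  Compactness (\<open>compact_embedding_L2\<close>) replaces weak convergence. On a cube of a grid of mesh
  \<open>1 / N\<close> the variance of \<open>u\<close> is a double integral of \<open>(u(x) - u(y))\<^sup>2\<close> over pairs of nearby points,
  so up to an error \<open>C N powr (- 2 s) [u]\<^sup>2\<close> the \<open>L\<^sup>2\<close> norm of \<open>u\<close> is controlled by its finitely many
  averages over the cubes that meet \<open>\<Omega>\<close> (\<open>grid_estimate\<close>). Along a bounded sequence all these
  averages, for all \<open>N\<close>, converge on a diagonal subsequence, which is then Cauchy in \<open>L\<^sup>2\<close>. A further
  subsequence converges almost everywhere, and Fatou's lemma gives the lower semicontinuity of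
  \<open>[u]\<^sup>2\<close>. The direct method thus yields a minimiser of \<open>J\<close>
  (\<open>euler_functional_minimizer_exists\<close>), and also shows that the first eigenvalue is attained
  (\<open>first_eigenvalue_attained\<close>). Passing from \<open>u\<close> to \<open>\<bar>u\<bar>\<close> does not increase \<open>J\<close>, so the minimiser
  may be taken non-negative; differentiating \<open>J\<close> along \<open>u + t \<phi>\<close> gives the weak equation
  (\<open>euler_lagrange\<close>).

  Finally, the bound on \<open>\<alpha>\<close> implies that \<open>F(t) \<ge> c t\<^sup>2\<close> near \<open>0\<close> for some \<open>c\<close> with
  \<open>2 \<alpha> c > \<lambda>\<^sub>1\<close>. Testing \<open>J\<close> with a small multiple of a first eigenfunction gives a negative value
  (\<open>euler_functional_negative\<close>), while \<open>J(0) = 0\<close>; hence the minimiser is not zero.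
\<close>

section \<open>Borel representatives and the Gagliardo form\<close>

text \<open>
  Representatives are Borel and vanish everywhere off \<open>\<Omega>\<close>, so that Fubini's theorem applies directly
  to \<open>lborel\<close> and the exterior condition can be used pointwise. For open \<open>\<Omega>\<close> every class of functions
  in \<open>X0\<close> has such a representative, see \<open>X0_borel_representative\<close>.
\<close>
definition dirichlet_space :: "real \<Rightarrow> (real ^ 'n) set \<Rightarrow> (real ^ 'n \<Rightarrow> real) set" where
  "dirichlet_space s \<Omega> = {u \<in> borel_measurable borel. (\<forall>x. x \<notin> \<Omega> \<longrightarrow> u x = 0) \<and>
     integrable lborel (\<lambda>x. (u x)\<^sup>2) \<and> integrable lborel (gagliardo_integrand s u u)}"

abbreviation energy :: "real \<Rightarrow> (real ^ 'n \<Rightarrow> real) \<Rightarrow> real" where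
  "energy s u \<equiv> gagliardo_form s u u"

lemma dirichlet_spaceD:
  assumes "u \<in> dirichlet_space s \<Omega>"
  shows "u \<in> borel_measurable borel" "\<And>x. x \<notin> \<Omega> \<Longrightarrow> u x = 0"
    "integrable lborel (\<lambda>x. (u x)\<^sup>2)" "integrable lborel (gagliardo_integrand s u u)"
  using assms by (auto simp: dirichlet_space_def)

lemma borel_measurable_gagliardo_integrand [measurable]:
  fixes u v :: "real ^ 'n \<Rightarrow> real"
  assumes [measurable]: "u \<in> borel_measurable borel" "v \<in> borel_measurable borel"
  shows "gagliardo_integrand s u v \<in> borel_measurable borel"
proof -
  have "gagliardo_integrand s u v \<in> borel_measurable (borel \<Otimes>\<^sub>M borel)"
    unfolding gagliardo_integrand_def by measurable
  then show ?thesis by (simp add: borel_prod)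
qed

lemma gagliardo_form_lborel:
  fixes u v :: "real ^ 'n \<Rightarrow> real"
  assumes [measurable]: "u \<in> borel_measurable borel" "v \<in> borel_measurable borel"
  shows "gagliardo_form s u v = (LINT z|lborel. gagliardo_integrand s u v z)"
  unfolding gagliardo_form_def by (rule integral_completion) simp

text \<open>
  If \<open>N\<close> is null in the factor, then \<open>N \<times> UNIV \<union> UNIV \<times> N\<close> is null in the product.
\<close>
lemma AE_lborel_prod:
  fixes P :: "'a::euclidean_space \<Rightarrow> bool"
  assumes "AE x in lborel. P x"
  shows "AE z in lborel. P (fst z) \<and> P (snd (z :: 'a \<times> 'a))"
proof -
  obtain N where N: "{x. \<not> P x} \<subseteq> N" "N \<in> sets lborel" "emeasure lborel N = 0"
    using assms by (auto elim!: AE_E)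
  have "N \<times> UNIV \<union> UNIV \<times> N \<in> null_sets (lborel \<Otimes>\<^sub>M lborel :: ('a \<times> 'a) measure)"
  proof (intro null_sets.Un null_setsI)
    show "N \<times> UNIV \<in> sets (lborel \<Otimes>\<^sub>M (lborel::'a measure))" "UNIV \<times> N \<in> sets ((lborel :: 'a measure) \<Otimes>\<^sub>M lborel)"
      using N by auto
    show "emeasure (lborel \<Otimes>\<^sub>M (lborel :: 'a measure)) (N \<times> UNIV) = 0"
      using N by (subst lborel.emeasure_pair_measure_Times) auto
    show "emeasure ((lborel :: 'a measure) \<Otimes>\<^sub>M lborel) (UNIV \<times> N) = 0"
      using N by (subst lborel.emeasure_pair_measure_Times) auto
  qed
  then show ?thesis
    unfolding lborel_prod by (rule AE_I') (use N in auto)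
qed

lemma gagliardo_integrand_cong_AE:
  fixes u v u' v' :: "real ^ 'n \<Rightarrow> real"
  assumes "AE x in lborel. u x = u' x" "AE x in lborel. v x = v' x"
  shows "AE z in lborel. gagliardo_integrand s u v z = gagliardo_integrand s u' v' z"
proof -
  have "AE z in lborel. (u (fst z) = u' (fst z) \<and> v (fst z) = v' (fst z)) \<and>
     (u (snd z) = u' (snd z) \<and> v (snd (z::(real^'n)\<times>(real^'n))) = v' (snd z))"
    by (rule AE_lborel_prod) (use assms in auto)
  then show ?thesis
    by eventually_elim (auto simp: gagliardo_integrand_def case_prod_beta)
qed

lemma gagliardo_form_cong_AE:
  fixes u v u' v' :: "real ^ 'n \<Rightarrow> real"
  assumes [measurable]: "u' \<in> borel_measurable borel" "v' \<in> borel_measurable borel"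
    and "AE x in lborel. u x = u' x" "AE x in lborel. v x = v' x"
  shows "gagliardo_form s u v = gagliardo_form s u' v'"
    and "integrable lebesgue (gagliardo_integrand s u v) \<longleftrightarrow>
         integrable lborel (gagliardo_integrand s u' v')"
proof -
  have eq: "AE z in lebesgue. gagliardo_integrand s u v z = gagliardo_integrand s u' v' z"
    using gagliardo_integrand_cong_AE[OF assms(3,4)] by (simp add: AE_completion_iff)
  have m': "gagliardo_integrand s u' v' \<in> borel_measurable lebesgue"
    by (rule measurable_completion) simp
  have "AE z in lebesgue. gagliardo_integrand s u' v' z = gagliardo_integrand s u v z"
    using eq by eventually_elim simp
  then have m: "gagliardo_integrand s u v \<in> borel_measurable lebesgue"
    using borel_measurable_AE[OF m'] by blast
  show "gagliardo_form s u v = gagliardo_form s u' v'"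
    unfolding gagliardo_form_def by (rule integral_cong_AE[OF m m' eq])
  have "integrable lebesgue (gagliardo_integrand s u v) \<longleftrightarrow>
        integrable lebesgue (gagliardo_integrand s u' v')"
    by (rule integrable_cong_AE[OF m m' eq])
  also have "\<dots> \<longleftrightarrow> integrable lborel (gagliardo_integrand s u' v')"
    by (rule integrable_completion) simp
  finally show "integrable lebesgue (gagliardo_integrand s u v) \<longleftrightarrow>
         integrable lborel (gagliardo_integrand s u' v')" .
qed

lemma X0_borel_representative:
  assumes u: "u \<in> X0 s \<Omega>" and "open \<Omega>"
  obtains v where "v \<in> dirichlet_space s \<Omega>" "AE x in lborel. u x = v x"
proof -
  have um: "u \<in> borel_measurable lebesgue" and u2: "integrable lebesgue (\<lambda>x. (u x)\<^sup>2)"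
    and ui: "integrable lebesgue (gagliardo_integrand s u u)"
    and u0: "AE x in lborel. x \<notin> \<Omega> \<longrightarrow> u x = 0"
    using u by (auto simp: X0_def sobolev_space_def AE_completion_iff)
  obtain w where w: "w \<in> borel_measurable lborel" "AE x in lborel. u x = w x"
    using completion_ex_borel_measurable_real[OF um] by blast
  define v where "v x = w x * indicator \<Omega> x" for x
  have [measurable]: "\<Omega> \<in> sets borel" "w \<in> borel_measurable borel" using \<open>open \<Omega>\<close> w by auto
  have vm [measurable]: "v \<in> borel_measurable borel" unfolding v_def by measurable
  have uv: "AE x in lborel. u x = v x"
    using u0 w(2) by eventually_elim (auto simp: v_def indicator_def)
  have "integrable lebesgue (\<lambda>x. (v x)\<^sup>2)"
  proof (rule iffD1[OF integrable_cong_AE u2])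
    show "(\<lambda>x. (u x)\<^sup>2) \<in> borel_measurable lebesgue" using um by measurable
    show "(\<lambda>x. (v x)\<^sup>2) \<in> borel_measurable lebesgue" by (rule measurable_completion) measurable
    show "AE x in lebesgue. (u x)\<^sup>2 = (v x)\<^sup>2"
      unfolding AE_completion_iff using uv by eventually_elim simp
  qed
  then have "integrable lborel (\<lambda>x. (v x)\<^sup>2)" by (subst (asm) integrable_completion) measurable
  moreover have "integrable lborel (gagliardo_integrand s v v)"
    using ui gagliardo_form_cong_AE(2)[OF vm vm uv uv, of s] by simp
  ultimately have "v \<in> dirichlet_space s \<Omega>"
    by (auto simp: dirichlet_space_def) (auto simp: v_def)
  then show thesis using that uv by blast
qed

lemma dirichlet_space_subset_X0: "dirichlet_space s \<Omega> \<subseteq> X0 s \<Omega>"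
proof
  fix u assume u: "u \<in> dirichlet_space s \<Omega>"
  note [measurable] = dirichlet_spaceD(1)[OF u]
  have "u \<in> borel_measurable lebesgue" by (rule measurable_completion) simp
  moreover have "integrable lebesgue (\<lambda>x. (u x)\<^sup>2)"
    by (subst integrable_completion) (use dirichlet_spaceD(3)[OF u] in auto)
  moreover have "integrable lebesgue (gagliardo_integrand s u u)"
    by (subst integrable_completion) (use dirichlet_spaceD(4)[OF u] in auto)
  ultimately show "u \<in> X0 s \<Omega>" using dirichlet_spaceD(2)[OF u]
    by (auto simp: X0_def sobolev_space_def)
qed

lemma gagliardo_integrand_nonneg: "0 \<le> gagliardo_integrand s u u z"
  by (auto simp: gagliardo_integrand_def split: prod.split)

lemma energy_nonneg: "0 \<le> energy s u"
  unfolding gagliardo_form_def by (rule Bochner_Integration.integral_nonneg) (rule gagliardo_integrand_nonneg)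

text \<open>
  Young's inequality \<open>\<bar>a b\<bar> \<le> a\<^sup>2 + b\<^sup>2\<close>; it makes the bilinear form finite on functions of finite energy.
\<close>
lemma gagliardo_integrand_abs_le:
  "\<bar>gagliardo_integrand s u v z\<bar> \<le> gagliardo_integrand s u u z + gagliardo_integrand s v v z"
proof (cases z)
  case (Pair x y)
  define a b where "a = u x - u y" and "b = v x - v y"
  have "0 \<le> \<bar>a\<bar> * \<bar>b\<bar>" by simp
  moreover have "2 * (\<bar>a\<bar> * \<bar>b\<bar>) \<le> a * a + b * b"
    using sum_squares_bound[of "\<bar>a\<bar>" "\<bar>b\<bar>"]
    by (simp add: power2_eq_square mult.assoc)
  ultimately have "\<bar>a * b\<bar> \<le> a * a + b * b" unfolding abs_mult by linarith
  then have "\<bar>a * b\<bar> / norm (x - y) powr (real CARD('a) + 2 * s)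
      \<le> (a * a + b * b) / norm (x - y) powr (real CARD('a) + 2 * s)"
    by (rule divide_right_mono) simp
  then show ?thesis
    by (simp add: Pair gagliardo_integrand_def a_def b_def abs_mult add_divide_distrib)
qed

lemma gagliardo_integrand_expand:
  "gagliardo_integrand s (\<lambda>x. u x + t * v x) (\<lambda>x. u x + t * v x) z =
   gagliardo_integrand s u u z + (2 * t * gagliardo_integrand s u v z + t\<^sup>2 * gagliardo_integrand s v v z)"
proof (cases z)
  case (Pair x y)
  define w where "w = norm (x - y) powr (real CARD('a) + 2 * s)"
  have "(u x + t * v x - (u y + t * v y)) * (u x + t * v x - (u y + t * v y)) =
     (u x - u y) * (u x - u y) + (2 * t * ((u x - u y) * (v x - v y)) + t\<^sup>2 * ((v x - v y) * (v x - v y)))"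
    by (simp add: power2_eq_square algebra_simps)
  then show ?thesis
    unfolding Pair gagliardo_integrand_def prod.case w_def[symmetric]
    by (simp only: add_divide_distrib times_divide_eq_right)
qed

lemma integrable_gagliardo_integrand:
  assumes u: "u \<in> dirichlet_space s \<Omega>" and v: "v \<in> dirichlet_space s \<Omega>"
  shows "integrable lborel (gagliardo_integrand s u v)"
proof (rule Bochner_Integration.integrable_bound)
  note [measurable] = dirichlet_spaceD(1)[OF u] dirichlet_spaceD(1)[OF v]
  show "integrable lborel (\<lambda>z. gagliardo_integrand s u u z + gagliardo_integrand s v v z)"
    using dirichlet_spaceD(4)[OF u] dirichlet_spaceD(4)[OF v] by simp
  show "gagliardo_integrand s u v \<in> borel_measurable lborel" by simp
  show "AE z in lborel. norm (gagliardo_integrand s u v z)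
      \<le> norm (gagliardo_integrand s u u z + gagliardo_integrand s v v z)"
    by (auto simp: gagliardo_integrand_nonneg intro: order_trans[OF gagliardo_integrand_abs_le])
qed

lemma integrable_mult_of_squares:
  fixes f g :: "'a \<Rightarrow> real"
  assumes [measurable]: "f \<in> borel_measurable M" "g \<in> borel_measurable M"
    and "integrable M (\<lambda>x. (f x)\<^sup>2)" "integrable M (\<lambda>x. (g x)\<^sup>2)"
  shows "integrable M (\<lambda>x. f x * g x)"
proof (rule Bochner_Integration.integrable_bound)
  show "integrable M (\<lambda>x. (f x)\<^sup>2 + (g x)\<^sup>2)" using assms by simp
  show "AE x in M. norm (f x * g x) \<le> norm ((f x)\<^sup>2 + (g x)\<^sup>2)"
  proof (intro AE_I2)
    fix x
    have "2 * \<bar>f x\<bar> * \<bar>g x\<bar> \<le> (f x)\<^sup>2 + (g x)\<^sup>2"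
      using sum_squares_bound[of "\<bar>f x\<bar>" "\<bar>g x\<bar>"] by simp
    moreover have "0 \<le> \<bar>f x\<bar> * \<bar>g x\<bar>" by simp
    ultimately have "\<bar>f x\<bar> * \<bar>g x\<bar> \<le> (f x)\<^sup>2 + (g x)\<^sup>2" by linarith
    then show "norm (f x * g x) \<le> norm ((f x)\<^sup>2 + (g x)\<^sup>2)" by (simp add: abs_mult)
  qed
qed measurable

lemma dirichlet_space_add_scaled:
  assumes u: "u \<in> dirichlet_space s \<Omega>" and v: "v \<in> dirichlet_space s \<Omega>"
  shows "(\<lambda>x. u x + t * v x) \<in> dirichlet_space s \<Omega>"
    and "energy s (\<lambda>x. u x + t * v x) =
      energy s u + (2 * t * gagliardo_form s u v + t\<^sup>2 * energy s v)"
proof -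
  note [measurable] = dirichlet_spaceD(1)[OF u] dirichlet_spaceD(1)[OF v]
  note I = dirichlet_spaceD(4)[OF u] dirichlet_spaceD(4)[OF v] integrable_gagliardo_integrand[OF u v]
  have "integrable lborel (\<lambda>x. (u x)\<^sup>2 + (2 * t * (u x * v x) + t\<^sup>2 * (v x)\<^sup>2))"
    using dirichlet_spaceD(3)[OF u] dirichlet_spaceD(3)[OF v]
    by (intro Bochner_Integration.integrable_add integrable_mult_right integrable_mult_of_squares) auto
  moreover have "(\<lambda>x. (u x)\<^sup>2 + (2 * t * (u x * v x) + t\<^sup>2 * (v x)\<^sup>2)) = (\<lambda>x. (u x + t * v x)\<^sup>2)"
    by (auto simp: power2_eq_square algebra_simps)
  ultimately have sq: "integrable lborel (\<lambda>x. (u x + t * v x)\<^sup>2)" by simp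
  have "integrable lborel (gagliardo_integrand s (\<lambda>x. u x + t * v x) (\<lambda>x. u x + t * v x))"
    unfolding gagliardo_integrand_expand using I by simp
  then show "(\<lambda>x. u x + t * v x) \<in> dirichlet_space s \<Omega>"
    using sq dirichlet_spaceD(2)[OF u] dirichlet_spaceD(2)[OF v] by (auto simp: dirichlet_space_def)
  show "energy s (\<lambda>x. u x + t * v x) =
      energy s u + (2 * t * gagliardo_form s u v + t\<^sup>2 * energy s v)"
    using I by (simp add: gagliardo_form_lborel gagliardo_integrand_expand)
qed

lemma zero_in_dirichlet_space: "(\<lambda>x. 0) \<in> dirichlet_space s \<Omega>" "energy s (\<lambda>x. 0) = 0"
  by (auto simp: dirichlet_space_def gagliardo_form_def gagliardo_integrand_def split_def)

lemma energy_scale: "energy s (\<lambda>x. t * u x) = t\<^sup>2 * energy s u"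
  and dirichlet_space_scale: "u \<in> dirichlet_space s \<Omega> \<Longrightarrow> (\<lambda>x. t * u x) \<in> dirichlet_space s \<Omega>"
proof -
  have "gagliardo_integrand s (\<lambda>x. t * u x) (\<lambda>x. t * u x) = (\<lambda>z. t\<^sup>2 * gagliardo_integrand s u u z)"
    using gagliardo_integrand_expand[of s "\<lambda>_. 0" t u] by (auto simp: gagliardo_integrand_def case_prod_beta)
  then show "energy s (\<lambda>x. t * u x) = t\<^sup>2 * energy s u" by (simp add: gagliardo_form_def)
  show "u \<in> dirichlet_space s \<Omega> \<Longrightarrow> (\<lambda>x. t * u x) \<in> dirichlet_space s \<Omega>"
    using dirichlet_space_add_scaled(1)[OF zero_in_dirichlet_space(1), of u s \<Omega> t] by simp
qed

lemma energy_diff_le: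
  assumes u: "u \<in> dirichlet_space s \<Omega>" and v: "v \<in> dirichlet_space s \<Omega>"
  shows "(\<lambda>x. u x - v x) \<in> dirichlet_space s \<Omega>"
    and "energy s (\<lambda>x. u x - v x) \<le> 2 * energy s u + 2 * energy s v"
proof -
  show "(\<lambda>x. u x - v x) \<in> dirichlet_space s \<Omega>"
    using dirichlet_space_add_scaled(1)[OF u v, of "-1"] by simp
  have "0 \<le> energy s (\<lambda>x. u x + 1 * v x)" by (rule energy_nonneg)
  then show "energy s (\<lambda>x. u x - v x) \<le> 2 * energy s u + 2 * energy s v"
    using dirichlet_space_add_scaled(2)[OF u v, of "-1"] dirichlet_space_add_scaled(2)[OF u v, of 1] by simp
qed

text \<open>
  The reverse triangle inequality \<open>\<bar>\<bar>u x\<bar> - \<bar>u y\<bar>\<bar> \<le> \<bar>u x - u y\<bar>\<close>, used pointwise.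
\<close>
lemma dirichlet_space_abs:
  assumes u: "u \<in> dirichlet_space s \<Omega>"
  shows "(\<lambda>x. \<bar>u x\<bar>) \<in> dirichlet_space s \<Omega>" and "energy s (\<lambda>x. \<bar>u x\<bar>) \<le> energy s u"
proof -
  note [measurable] = dirichlet_spaceD(1)[OF u]
  have le: "gagliardo_integrand s (\<lambda>x. \<bar>u x\<bar>) (\<lambda>x. \<bar>u x\<bar>) z \<le> gagliardo_integrand s u u z" for z
  proof (cases z)
    case (Pair x y)
    have "(\<bar>u x\<bar> - \<bar>u y\<bar>)\<^sup>2 \<le> (u x - u y)\<^sup>2" by (rule abs_le_square_iff[THEN iffD1]) simp
    then show ?thesis
      by (simp add: Pair gagliardo_integrand_def power2_eq_square divide_right_mono)
  qed
  have i: "integrable lborel (gagliardo_integrand s (\<lambda>x. \<bar>u x\<bar>) (\<lambda>x. \<bar>u x\<bar>))"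
    by (rule Bochner_Integration.integrable_bound[OF dirichlet_spaceD(4)[OF u]])
      (auto simp: gagliardo_integrand_nonneg intro: le)
  then show "(\<lambda>x. \<bar>u x\<bar>) \<in> dirichlet_space s \<Omega>"
    using dirichlet_spaceD(1-3)[OF u] by (auto simp: dirichlet_space_def)
  show "energy s (\<lambda>x. \<bar>u x\<bar>) \<le> energy s u"
    using integral_mono[OF i dirichlet_spaceD(4)[OF u] le] by (simp add: gagliardo_form_lborel)
qed

section \<open>Poincare inequality\<close>

text \<open>
  A unit ball \<open>B\<close> is placed at a positive distance from \<open>\<Omega>\<close>. For \<open>x \<in> \<Omega>\<close> and \<open>y \<in> B\<close> one has \<open>u y = 0\<close>,
  and \<open>norm (x - y)\<close> is bounded, so the Gagliardo integrand is at least a constant times \<open>(u x)\<^sup>2\<close>.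
  Integrating over \<open>\<Omega> \<times> B\<close> gives the claim.
\<close>
lemma poincare_inequality:
  fixes \<Omega> :: "(real ^ 'n) set"
  assumes "bounded \<Omega>" and "0 < s"
  obtains C where "0 < C" "\<And>u. u \<in> dirichlet_space s \<Omega> \<Longrightarrow> (LINT x|lborel. (u x)\<^sup>2) \<le> C * energy s u"
proof -
  obtain R where R: "0 < R" "\<And>x. x \<in> \<Omega> \<Longrightarrow> norm x < R"
    using \<open>bounded \<Omega>\<close> by (auto simp: bounded_pos_less)
  define p :: "real ^ 'n" where "p = (R + 1) *\<^sub>R axis undefined 1"
  have np: "norm p = R + 1" using R by (simp add: p_def)
  define B where "B = ball p 1"
  define D where "D = (2 * R + 2) powr (real CARD('n) + 2 * s)"
  have Bnorm: "R < norm y" "norm y < R + 2" if "y \<in> B" for y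
    using that norm_triangle_ineq2[of p y] norm_triangle_ineq2[of y p] np
    by (auto simp: B_def dist_norm norm_minus_commute)
  have mB: "0 < measure lborel B" "emeasure lborel B = ennreal (measure lborel B)"
    unfolding B_def using emeasure_lborel_ball_finite[of p 1]
    by (auto simp: emeasure_eq_ennreal_measure top_unique less_top)
  have "0 < D" using R by (simp add: D_def)
  show thesis
  proof
    show "0 < D / measure lborel B" using \<open>0 < D\<close> mB by simp
    fix u assume u: "u \<in> dirichlet_space s \<Omega>"
    note [measurable] = dirichlet_spaceD(1)[OF u]
    have [measurable]: "B \<in> sets borel" by (simp add: B_def)
    have pt: "(u (fst z))\<^sup>2 * indicator B (snd z) \<le> D * gagliardo_integrand s u u z" for z
    proof (cases "fst z \<in> \<Omega> \<and> snd z \<in> B")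
      case True
      obtain x y where z: "z = (x, y)" by (cases z)
      have xy: "x \<in> \<Omega>" "y \<in> B" using True z by auto
      then have uy: "u y = 0" and ne: "x \<noteq> y"
        using Bnorm(1)[of y] R(2)[of x] R(2)[of y] dirichlet_spaceD(2)[OF u] by force+
      have "norm (x - y) \<le> 2 * R + 2"
        using norm_triangle_ineq4[of x y] R(2)[OF xy(1)] Bnorm(2)[OF xy(2)] by simp
      then have *: "norm (x - y) powr (real CARD('n) + 2 * s) \<le> D"
        unfolding D_def using \<open>0 < s\<close> by (intro powr_mono2) auto
      have "0 < norm (x - y) powr (real CARD('n) + 2 * s)" using ne by simp
      then have "1 \<le> D / norm (x - y) powr (real CARD('n) + 2 * s)" using * by simp
      from mult_left_mono[OF this, of "(u x)\<^sup>2"] show ?thesis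
        using xy uy by (simp add: z gagliardo_integrand_def power2_eq_square mult_ac)
    next
      case False
      then have "(u (fst z))\<^sup>2 * indicator B (snd z) = 0"
        using dirichlet_spaceD(2)[OF u] by (auto simp: indicator_def)
      then show ?thesis using \<open>0 < D\<close> gagliardo_integrand_nonneg[of s u z] by (metis less_imp_le mult_nonneg_nonneg)
    qed
    have "(\<integral>\<^sup>+z. ennreal ((u (fst z))\<^sup>2 * indicator B (snd z)) \<partial>(lborel \<Otimes>\<^sub>M lborel)) =
        (\<integral>\<^sup>+x. \<integral>\<^sup>+y. ennreal ((u x)\<^sup>2) * indicator B y \<partial>lborel \<partial>lborel)"
      by (subst lborel.nn_integral_fst[symmetric])
         (auto intro!: nn_integral_cong simp: ennreal_mult ennreal_indicator)
    also have "\<dots> = (\<integral>\<^sup>+x. ennreal ((u x)\<^sup>2) \<partial>lborel) * emeasure lborel B"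
      by (simp add: nn_integral_cmult nn_integral_multc)
    also have "\<dots> = ennreal ((LINT x|lborel. (u x)\<^sup>2) * measure lborel B)"
      using dirichlet_spaceD(3)[OF u] mB by (simp add: nn_integral_eq_integral ennreal_mult)
    finally have "ennreal ((LINT x|lborel. (u x)\<^sup>2) * measure lborel B) =
      (\<integral>\<^sup>+z. ennreal ((u (fst z))\<^sup>2 * indicator B (snd z)) \<partial>lborel)" by (simp add: lborel_prod)
    also have "\<dots> \<le> (\<integral>\<^sup>+z. ennreal (D * gagliardo_integrand s u u z) \<partial>lborel)"
      by (intro nn_integral_mono ennreal_leI pt)
    also have "\<dots> = ennreal (D * energy s u)"
      using dirichlet_spaceD(4)[OF u] \<open>0 < D\<close>
      by (subst nn_integral_eq_integral) (auto simp: gagliardo_integrand_nonneg gagliardo_form_lborel)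
    finally have "(LINT x|lborel. (u x)\<^sup>2) * measure lborel B \<le> D * energy s u"
      using \<open>0 < D\<close> energy_nonneg[of s u] by (simp add: ennreal_le_iff)
    then show "(LINT x|lborel. (u x)\<^sup>2) \<le> D / measure lborel B * energy s u"
      using mB by (simp add: field_simps)
  qed
qed

section \<open>Averages over a grid of cubes\<close>

lemma lborel_integral_product:
  fixes f g :: "'a::euclidean_space \<Rightarrow> real"
  assumes "integrable lborel f" "integrable lborel g"
  shows "integrable lborel (\<lambda>z. f (fst z) * g (snd z))"
    and "(LINT z|lborel. f (fst z) * g (snd z)) = (LINT x|lborel. f x) * (LINT y|lborel. g y)"
proof -
  have [measurable]: "f \<in> borel_measurable borel" "g \<in> borel_measurable borel" using assms by auto
  have i: "integrable (lborel \<Otimes>\<^sub>M lborel) (\<lambda>z. f (fst z) * g (snd z))"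
    using assms by (intro lborel_pair.Fubini_integrable) (auto simp: abs_mult)
  then show "integrable lborel (\<lambda>z. f (fst z) * g (snd z))" by (simp add: lborel_prod)
  show "(LINT z|lborel. f (fst z) * g (snd z)) = (LINT x|lborel. f x) * (LINT y|lborel. g y)"
    using lborel_pair.integral_fst'[OF i] by (simp add: lborel_prod)
qed

text \<open>
  The variance identity, obtained by expanding the square. It expresses the \<open>L\<^sup>2\<close> distance of \<open>d\<close> from
  its mean on \<open>Q\<close> by differences of values of \<open>d\<close> only.
\<close>
lemma double_integral_square_difference:
  fixes d :: "'a::euclidean_space \<Rightarrow> real"
  assumes [measurable]: "Q \<in> sets borel" "d \<in> borel_measurable borel"
    and fin: "emeasure lborel Q < \<infinity>" and sq: "integrable lborel (\<lambda>x. (d x)\<^sup>2)"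
  shows "integrable lborel (\<lambda>z. indicator (Q \<times> Q) z * (d (fst z) - d (snd z))\<^sup>2)"
    and "(LINT z|lborel. indicator (Q \<times> Q) z * (d (fst z) - d (snd z))\<^sup>2) =
      2 * (measure lborel Q * (LINT x:Q|lborel. (d x)\<^sup>2)) - 2 * (LINT x:Q|lborel. d x)\<^sup>2"
proof -
  define q :: "'a \<Rightarrow> real" where "q = indicator Q"
  have [measurable]: "q \<in> borel_measurable borel" by (simp add: q_def)
  have q2: "q x * q x = q x" for x by (simp add: q_def indicator_def)
  have iq: "integrable lborel q" unfolding q_def using fin by (intro integrable_real_indicator) auto
  have iqd2: "integrable lborel (\<lambda>x. q x * (d x)\<^sup>2)"
    using integrable_real_mult_indicator[of Q lborel "\<lambda>x. (d x)\<^sup>2"] sq by (simp add: q_def mult.commute)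
  have iqd: "integrable lborel (\<lambda>x. q x * d x)"
    using integrable_mult_of_squares[of q lborel d] iq sq q2 by (simp add: power2_eq_square)
  note p = lborel_integral_product
  have eq: "indicator (Q \<times> Q) z * (d (fst z) - d (snd z))\<^sup>2 =
     (q (fst z) * (d (fst z))\<^sup>2) * q (snd z) - 2 * ((q (fst z) * d (fst z)) * (q (snd z) * d (snd z)))
      + q (fst z) * (q (snd z) * (d (snd z))\<^sup>2)" for z
    by (cases z) (auto simp: q_def indicator_def power2_eq_square algebra_simps)
  show "integrable lborel (\<lambda>z. indicator (Q \<times> Q) z * (d (fst z) - d (snd z))\<^sup>2)"
    unfolding eq by (intro Bochner_Integration.integrable_add Bochner_Integration.integrable_diff
        integrable_mult_right p(1) iq iqd iqd2)
  have m: "(LINT x|lborel. q x) = measure lborel Q" using fin by (simp add: q_def)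
  show "(LINT z|lborel. indicator (Q \<times> Q) z * (d (fst z) - d (snd z))\<^sup>2) =
      2 * (measure lborel Q * (LINT x:Q|lborel. (d x)\<^sup>2)) - 2 * (LINT x:Q|lborel. d x)\<^sup>2"
    unfolding eq
    by (subst Bochner_Integration.integral_add Bochner_Integration.integral_diff integral_mult_right_zero,
        (intro Bochner_Integration.integrable_diff integrable_mult_right p(1) iq iqd iqd2)+)+
       (simp add: p(2)[OF iqd2 iq] p(2)[OF iqd iqd] p(2)[OF iq iqd2] m set_lebesgue_integral_def q_def[symmetric] power2_eq_square[of "integral\<^sup>L _ _"])
qed

text \<open>
  Half-open cubes of side \<open>1 / N\<close>, indexed by the integer part of \<open>N *\<^sub>R x\<close>; for \<open>N > 0\<close> they partition
  the space.
\<close>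
definition grid_cell :: "nat \<Rightarrow> int ^ 'n \<Rightarrow> (real ^ 'n) set" where
  "grid_cell N a = {x. (\<chi> i. \<lfloor>real N * x $ i\<rfloor>) = a}"

lemma grid_cell_borel [measurable]: "grid_cell N a \<in> sets borel"
proof -
  have "grid_cell N a = {x \<in> space borel. \<forall>i. \<lfloor>real N * x $ i\<rfloor> = a $ i}"
    by (auto simp: grid_cell_def vec_eq_iff)
  also have "\<dots> \<in> sets borel" by measurable
  finally show ?thesis .
qed

text \<open>
  Each coordinate varies by at most \<open>1 / N\<close> in a cell; the \<open>l\<^sup>1\<close> norm dominates the Euclidean norm.
\<close>
lemma norm_diff_grid_cell:
  fixes x y :: "real ^ 'n"
  assumes "0 < N" "x \<in> grid_cell N a" "y \<in> grid_cell N a"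
  shows "norm (x - y) \<le> real CARD('n) / real N"
proof -
  have "\<bar>(x - y) $ i\<bar> \<le> 1 / real N" for i
  proof -
    have "\<lfloor>real N * x $ i\<rfloor> = \<lfloor>real N * y $ i\<rfloor>"
      using assms by (auto simp: grid_cell_def vec_eq_iff)
    then have "\<bar>real N * x $ i - real N * y $ i\<bar> \<le> 1" by linarith
    then have "real N * \<bar>x $ i - y $ i\<bar> \<le> 1"
      by (metis abs_mult abs_of_nat right_diff_distrib)
    then show ?thesis using \<open>0 < N\<close> by (simp add: field_simps)
  qed
  then have "(\<Sum>i\<in>UNIV. \<bar>(x - y) $ i\<bar>) \<le> (\<Sum>i\<in>(UNIV::'n set). 1 / real N)" by (intro sum_mono)
  then show ?thesis using norm_le_l1_cart[of "x - y"] by simp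
qed

lemma measure_grid_cell:
  fixes a :: "int ^ 'n"
  assumes "0 < N"
  shows "emeasure lborel (grid_cell N a) < \<infinity>"
    and "1 / real N ^ CARD('n) \<le> measure lborel (grid_cell N a)"
proof -
  define l u :: "real ^ 'n" where "l = (\<chi> i. of_int (a $ i) / N)" and "u = (\<chi> i. (of_int (a $ i) + 1) / N)"
  have sub: "grid_cell N a \<subseteq> cbox l u"
  proof
    fix x assume "x \<in> grid_cell N a"
    then have "\<lfloor>real N * x $ i\<rfloor> = a $ i" for i by (auto simp: grid_cell_def vec_eq_iff)
    then have "of_int (a $ i) \<le> real N * x $ i \<and> real N * x $ i \<le> of_int (a $ i) + 1" for i
      using floor_correct[of "real N * x $ i"] by auto
    then show "x \<in> cbox l u" using \<open>0 < N\<close>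
      by (auto simp: mem_box_cart l_def u_def field_simps)
  qed
  then have "emeasure lborel (grid_cell N a) \<le> emeasure lborel (cbox l u)"
    by (intro emeasure_mono) auto
  then show fin: "emeasure lborel (grid_cell N a) < \<infinity>"
    using emeasure_lborel_cbox_finite[of l u] by (metis order_le_less_trans infinity_ennreal_def)
  have sub': "box l u \<subseteq> grid_cell N a"
  proof
    fix x assume "x \<in> box l u"
    then have "of_int (a $ i) < real N * x $ i \<and> real N * x $ i < of_int (a $ i) + 1" for i
      using \<open>0 < N\<close> by (auto simp: mem_box_cart l_def u_def field_simps)
    then have "\<lfloor>real N * x $ i\<rfloor> = a $ i" for i by (intro floor_unique) (auto intro: less_imp_le)
    then show "x \<in> grid_cell N a" by (simp add: grid_cell_def vec_eq_iff)
  qed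
  have "cbox l u \<noteq> {}" by (auto simp: interval_ne_empty_cart l_def u_def divide_right_mono)
  then have "measure lborel (box l u) = (\<Prod>i\<in>UNIV. u $ i - l $ i)"
    using content_cbox_cart[of l u] by (simp add: measure_lborel_box_eq measure_lborel_cbox_eq)
  also have "\<dots> = 1 / real N ^ CARD('n)"
    by (simp add: u_def l_def add_divide_distrib power_one_over)
  finally have "measure lborel (box l u) = 1 / real N ^ CARD('n)" .
  moreover have "measure lborel (box l u) \<le> measure lborel (grid_cell N a)"
    using sub' fin by (intro measure_mono_fmeasurable) (auto simp: fmeasurable_def)
  ultimately show "1 / real N ^ CARD('n) \<le> measure lborel (grid_cell N a)" by simp
qed

lemma finite_grid_cells:
  fixes \<Omega> :: "(real ^ 'n) set"
  assumes "bounded \<Omega>"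
  shows "finite {a. grid_cell N a \<inter> \<Omega> \<noteq> {}}"
proof -
  obtain R where R: "\<And>x. x \<in> \<Omega> \<Longrightarrow> norm x \<le> R" using assms by (auto simp: bounded_iff)
  define S where "S = {- \<lceil>real N * R\<rceil> - 1 .. \<lceil>real N * R\<rceil>}"
  have "{a. grid_cell N a \<inter> \<Omega> \<noteq> {}} \<subseteq> vec_lambda ` (UNIV \<rightarrow> S)"
  proof
    fix a :: "int ^ 'n" assume "a \<in> {a. grid_cell N a \<inter> \<Omega> \<noteq> {}}"
    then obtain x where x: "x \<in> grid_cell N a" "x \<in> \<Omega>" by auto
    have "a $ i \<in> S" for i
    proof -
      have ai: "a $ i = \<lfloor>real N * x $ i\<rfloor>" using x by (auto simp: grid_cell_def)
      have "\<bar>x $ i\<bar> \<le> R" using component_le_norm_cart[of x i] R[OF x(2)] by simp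
      then have "real N * \<bar>x $ i\<bar> \<le> real N * R" by (intro mult_left_mono) auto
      then have "\<bar>real N * x $ i\<bar> \<le> real N * R" by (simp add: abs_mult)
      then show ?thesis unfolding ai S_def by (simp; linarith)
    qed
    then have "vec_nth a \<in> UNIV \<rightarrow> S" by auto
    then show "a \<in> vec_lambda ` (UNIV \<rightarrow> S)" by (metis image_eqI vec_nth_inverse)
  qed
  moreover have "finite (UNIV \<rightarrow> S :: ('n \<Rightarrow> int) set)"
    using finite_PiE[of "UNIV :: 'n set" "\<lambda>_. S"] by (simp add: S_def PiE_UNIV_domain)
  ultimately show ?thesis by (rule finite_subset[OF _ finite_imageI])
qed

text \<open>
  On each cell, the variance identity and \<open>measure Q \<ge> 1 / N ^ n\<close> bound \<open>\<integral>\<^bsub>Q\<^esub> d\<^sup>2\<close> by the squared integral of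
  \<open>d\<close> over \<open>Q\<close> and the double integral of \<open>(d x - d y)\<^sup>2\<close> over \<open>Q \<times> Q\<close>. Two points of \<open>Q\<close> are at most
  \<open>n / N\<close> apart, so the double integrals sum to at most \<open>(n / N) powr (n + 2 s)\<close> times the energy; after
  multiplication by \<open>N ^ n\<close> the factor \<open>N powr (- 2 s)\<close> remains, which tends to \<open>0\<close>.
\<close>
lemma grid_estimate:
  fixes \<Omega> :: "(real ^ 'n) set"
  assumes "bounded \<Omega>" and "0 < s" and "0 < N" and d: "d \<in> dirichlet_space s \<Omega>"
  shows "(LINT x|lborel. (d x)\<^sup>2) \<le>
     real N ^ CARD('n) * (\<Sum>a | grid_cell N a \<inter> \<Omega> \<noteq> {}. (LINT x:grid_cell N a|lborel. d x)\<^sup>2)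
     + real CARD('n) powr (real CARD('n) + 2 * s) * real N powr (- (2 * s)) * energy s d"
proof -
  note [measurable] = dirichlet_spaceD(1)[OF d]
  define A where "A = {a. grid_cell N a \<inter> \<Omega> \<noteq> {}}"
  have fA: "finite A" unfolding A_def by (rule finite_grid_cells) fact
  define p where "p = real CARD('n) + 2 * s"
  have "0 < p" using \<open>0 < s\<close> by (simp add: p_def)
  define I where "I a = (LINT z|lborel. indicator (grid_cell N a \<times> grid_cell N a) z * (d (fst z) - d (snd z))\<^sup>2)" for a
  note sq = dirichlet_spaceD(3)[OF d]
  note II = double_integral_square_difference[OF grid_cell_borel dirichlet_spaceD(1)[OF d] measure_grid_cell(1)[OF \<open>0 < N\<close>] sq]
  have I0: "0 \<le> I a" for a unfolding I_def by (rule Bochner_Integration.integral_nonneg) simp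
  have cell: "(LINT x:grid_cell N a|lborel. (d x)\<^sup>2) \<le>
      real N ^ CARD('n) * (LINT x:grid_cell N a|lborel. d x)\<^sup>2 + real N ^ CARD('n) * I a" for a
  proof -
    define m where "m = measure lborel (grid_cell N a)"
    define J where "J = (LINT x:grid_cell N a|lborel. (d x)\<^sup>2)"
    have "1 \<le> real N ^ CARD('n) * m"
      using measure_grid_cell(2)[OF \<open>0 < N\<close>, of a] \<open>0 < N\<close> by (simp add: m_def field_simps)
    moreover have "0 \<le> J"
      unfolding J_def set_lebesgue_integral_def by (rule Bochner_Integration.integral_nonneg) simp
    ultimately have "1 * J \<le> (real N ^ CARD('n) * m) * J" by (rule mult_right_mono)
    also have "\<dots> = real N ^ CARD('n) * (m * J)" by (rule mult.assoc)
    also have "m * J = I a / 2 + (LINT x:grid_cell N a|lborel. d x)\<^sup>2"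
      using II(2)[of a] unfolding I_def m_def J_def by linarith
    also have "\<dots> \<le> (LINT x:grid_cell N a|lborel. d x)\<^sup>2 + I a"
      using I0[of a] by linarith
    finally show ?thesis unfolding J_def[symmetric] by (simp add: distrib_left mult_left_mono)
  qed
  have in_cell: "x \<in> grid_cell N a \<longleftrightarrow> a = (\<chi> i. \<lfloor>real N * x $ i\<rfloor>)" for x a
    by (auto simp: grid_cell_def)
  have part: "(d x)\<^sup>2 = (\<Sum>a\<in>A. indicator (grid_cell N a) x * (d x)\<^sup>2)" for x
  proof (cases "x \<in> \<Omega>")
    case True
    then have "(\<chi> i. \<lfloor>real N * x $ i\<rfloor>) \<in> A" by (auto simp: A_def in_cell)
    moreover have "indicator (grid_cell N a) x * (d x)\<^sup>2 =
        (if a = (\<chi> i. \<lfloor>real N * x $ i\<rfloor>) then (d x)\<^sup>2 else 0)" for a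
      by (auto simp: in_cell indicator_def)
    ultimately show ?thesis using fA by simp
  qed (simp add: dirichlet_spaceD(2)[OF d])
  have int_cell: "integrable lborel (\<lambda>x. indicator (grid_cell N a) x * (d x)\<^sup>2)" for a
    using integrable_real_mult_indicator[of "grid_cell N a" lborel "\<lambda>x. (d x)\<^sup>2"] sq
    by (simp add: mult.commute)
  have "(LINT x|lborel. (d x)\<^sup>2) = (\<Sum>a\<in>A. LINT x:grid_cell N a|lborel. (d x)\<^sup>2)"
    by (subst part) (simp add: set_lebesgue_integral_def int_cell)
  also have "\<dots> \<le> (\<Sum>a\<in>A. real N ^ CARD('n) * (LINT x:grid_cell N a|lborel. d x)\<^sup>2 + real N ^ CARD('n) * I a)"
    by (intro sum_mono cell)
  also have "\<dots> = real N ^ CARD('n) * (\<Sum>a\<in>A. (LINT x:grid_cell N a|lborel. d x)\<^sup>2) + real N ^ CARD('n) * (\<Sum>a\<in>A. I a)"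
    by (simp add: sum.distrib sum_distrib_left)
  also have "(\<Sum>a\<in>A. I a) = (LINT z|lborel. (\<Sum>a\<in>A. indicator (grid_cell N a \<times> grid_cell N a) z * (d (fst z) - d (snd z))\<^sup>2))"
    unfolding I_def by (rule Bochner_Integration.integral_sum[symmetric]) (rule II(1))
  also have "\<dots> \<le> (LINT z|lborel. (real CARD('n) / real N) powr p * gagliardo_integrand s d d z)"
  proof (rule integral_mono)
    show "integrable lborel (\<lambda>z. \<Sum>a\<in>A. indicator (grid_cell N a \<times> grid_cell N a) z * (d (fst z) - d (snd z))\<^sup>2)"
      by (intro Bochner_Integration.integrable_sum II(1))
    show "integrable lborel (\<lambda>z. (real CARD('n) / real N) powr p * gagliardo_integrand s d d z)"
      using dirichlet_spaceD(4)[OF d] by simp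
    fix z :: "(real ^ 'n) \<times> (real ^ 'n)"
    obtain x y where z: "z = (x, y)" by (cases z)
    define c where "c = (\<chi> i. \<lfloor>real N * x $ i\<rfloor>)"
    have e: "indicator (grid_cell N a \<times> grid_cell N a) z * (d (fst z) - d (snd z))\<^sup>2
        = (if a = c then (if y \<in> grid_cell N c then (d x - d y)\<^sup>2 else 0) else 0)" for a
      by (auto simp: z c_def in_cell indicator_def)
    have g0: "0 \<le> (real CARD('n) / real N) powr p * gagliardo_integrand s d d z"
      by (simp add: gagliardo_integrand_nonneg)
    have "(d x - d y)\<^sup>2 \<le> (real CARD('n) / real N) powr p * gagliardo_integrand s d d z" if y: "y \<in> grid_cell N c"
    proof (cases "x = y")
      case False
      have "x \<in> grid_cell N c" by (simp add: in_cell c_def)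
      then have "norm (x - y) powr p \<le> (real CARD('n) / real N) powr p"
        using norm_diff_grid_cell[OF \<open>0 < N\<close> _ y] \<open>0 < p\<close> by (intro powr_mono2) auto
      moreover have "0 < norm (x - y) powr p" using False by simp
      ultimately have "1 \<le> (real CARD('n) / real N) powr p / norm (x - y) powr p" by simp
      from mult_left_mono[OF this, of "(d x - d y)\<^sup>2"] show ?thesis
        by (simp add: z gagliardo_integrand_def p_def power2_eq_square mult_ac)
    qed (use g0 in simp)
    then show "(\<Sum>a\<in>A. indicator (grid_cell N a \<times> grid_cell N a) z * (d (fst z) - d (snd z))\<^sup>2)
        \<le> (real CARD('n) / real N) powr p * gagliardo_integrand s d d z"
      unfolding e using fA g0 by simp
  qed
  also have "\<dots> = (real CARD('n) / real N) powr p * energy s d" by (simp add: gagliardo_form_lborel)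
  also have "real N ^ CARD('n) * ((real CARD('n) / real N) powr p * energy s d)
      = real CARD('n) powr p * real N powr (- (2 * s)) * energy s d"
  proof -
    have "real N ^ CARD('n) / real N powr p = real N powr (- (2 * s))"
      using \<open>0 < N\<close> by (simp add: powr_realpow[symmetric] powr_diff[symmetric] p_def)
    moreover have "real N ^ CARD('n) * ((real CARD('n) / real N) powr p * energy s d)
        = real CARD('n) powr p * (real N ^ CARD('n) / real N powr p) * energy s d"
      by (simp add: powr_divide)
    ultimately show ?thesis by simp
  qed
  finally show ?thesis using \<open>0 < N\<close> by (simp add: A_def p_def mult_left_mono)
qed

section \<open>Completeness of the square-integrable functions\<close>

text \<open>
  The Riesz-Fischer theorem. Along a subsequence the squared distance of consecutive terms is at
  most \<open>(1/4)^i\<close>, so \<open>\<Sum>i. 2^i * (d i x)\<^sup>2\<close> has a finite integral and is finite almost everywhere.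
  By \<open>2 \<bar>d\<bar> \<le> (1/2)^i + 2^i d\<^sup>2\<close> the telescoping series then converges absolutely, and Fatou's lemma
  upgrades the pointwise limit to an \<open>L\<^sup>2\<close> limit.
\<close>
lemma L2_Cauchy_converging_subsequence:
  fixes w :: "nat \<Rightarrow> 'a \<Rightarrow> real"
  assumes [measurable]: "\<And>k. w k \<in> borel_measurable M"
    and sq: "\<And>k. integrable M (\<lambda>x. (w k x)\<^sup>2)"
    and cauchy: "\<And>e. 0 < e \<Longrightarrow> \<exists>K. \<forall>j\<ge>K. \<forall>k\<ge>K. (LINT x|M. (w j x - w k x)\<^sup>2) < e"
  obtains r :: "nat \<Rightarrow> nat" and v where "strict_mono r" "v \<in> borel_measurable M" "integrable M (\<lambda>x. (v x)\<^sup>2)"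
    "AE x in M. (\<lambda>k. w (r k) x) \<longlonglongrightarrow> v x"
    "\<And>k. integrable M (\<lambda>x. (w (r k) x - v x)\<^sup>2)"
    "(\<lambda>k. LINT x|M. (w (r k) x - v x)\<^sup>2) \<longlonglongrightarrow> 0"
proof -
  have sqd: "integrable M (\<lambda>x. (w j x - w k x)\<^sup>2)" for j k
  proof (rule Bochner_Integration.integrable_bound)
    show "integrable M (\<lambda>x. 2 * (w j x)\<^sup>2 + 2 * (w k x)\<^sup>2)" using sq by simp
    show "AE x in M. norm ((w j x - w k x)\<^sup>2) \<le> norm (2 * (w j x)\<^sup>2 + 2 * (w k x)\<^sup>2)"
    proof (intro AE_I2)
      fix x have "0 \<le> (w j x + w k x)\<^sup>2" by simp
      then have "(w j x - w k x)\<^sup>2 \<le> 2 * (w j x)\<^sup>2 + 2 * (w k x)\<^sup>2"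
        by (simp add: power2_eq_square algebra_simps)
      then show "norm ((w j x - w k x)\<^sup>2) \<le> norm (2 * (w j x)\<^sup>2 + 2 * (w k x)\<^sup>2)"
        unfolding real_norm_def abs_power2 by (rule order_trans[OF _ abs_ge_self])
    qed
  qed simp
  have ex: "\<exists>K. \<forall>j\<ge>K. \<forall>k\<ge>K. (LINT x|M. (w j x - w k x)\<^sup>2) < (1/4)^i" for i :: nat
    by (rule cauchy) simp
  then obtain K where K: "\<And>i j k. K i \<le> j \<Longrightarrow> K i \<le> k \<Longrightarrow> (LINT x|M. (w j x - w k x)\<^sup>2) < (1/4)^i"
    by metis
  \<comment> \<open>The maximum with \<open>Suc m\<close> makes \<open>r\<close> strictly monotone while keeping \<open>K i \<le> r i\<close>.\<close>
  define r where "r = rec_nat (K 0) (\<lambda>i m. max (Suc m) (K (Suc i)))"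
  have r_Suc: "r (Suc i) = max (Suc (r i)) (K (Suc i))" for i by (simp add: r_def)
  have mono: "strict_mono r" by (auto simp: strict_mono_Suc_iff r_Suc less_max_iff_disj)
  have rK: "K i \<le> r i" for i by (cases i) (auto simp: r_Suc r_def)
  have small: "(\<integral>\<^sup>+x. ennreal ((w (r i) x - w (r j) x)\<^sup>2) \<partial>M) \<le> ennreal ((1/4)^i)" if "i \<le> j" for i j
  proof -
    have "r i \<le> r j" using mono that by (simp add: strict_mono_less_eq)
    then have "(LINT x|M. (w (r i) x - w (r j) x)\<^sup>2) < (1/4)^i" using rK[of i] by (intro K) auto
    then show ?thesis by (subst nn_integral_eq_integral[OF sqd]) (auto simp: ennreal_leI)
  qed
  define d where "d i x = w (r (Suc i)) x - w (r i) x" for i x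
  have [measurable]: "d i \<in> borel_measurable M" for i unfolding d_def by measurable
  have "(\<integral>\<^sup>+x. (\<Sum>i. ennreal (2^i * (d i x)\<^sup>2)) \<partial>M) = (\<Sum>i. \<integral>\<^sup>+x. ennreal (2^i * (d i x)\<^sup>2) \<partial>M)"
    by (rule nn_integral_suminf) measurable
  also have "\<dots> \<le> (\<Sum>i. ennreal ((1/2)^i))"
  proof (rule suminf_le)
    fix i
    have "(\<integral>\<^sup>+x. ennreal (2^i * (d i x)\<^sup>2) \<partial>M) = ennreal (2^i) * (\<integral>\<^sup>+x. ennreal ((w (r i) x - w (r (Suc i)) x)\<^sup>2) \<partial>M)"
      by (subst nn_integral_cmult[symmetric]) (auto simp: d_def ennreal_mult power2_commute)
    also have "\<dots> \<le> ennreal (2^i) * ennreal ((1/4)^i)" by (intro mult_left_mono small) auto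
    also have "\<dots> = ennreal ((1/2)^i)"
      by (simp add: ennreal_mult[symmetric] power_mult_distrib[symmetric] del: ennreal_power)
    finally show "(\<integral>\<^sup>+x. ennreal (2^i * (d i x)\<^sup>2) \<partial>M) \<le> ennreal ((1/2)^i)" .
  qed auto
  also have "\<dots> = ennreal (\<Sum>i. (1/2)^i)" by (rule suminf_ennreal2) (auto intro: summable_geometric)
  also have "\<dots> < \<infinity>" by simp
  finally have "(\<integral>\<^sup>+x. (\<Sum>i. ennreal (2^i * (d i x)\<^sup>2)) \<partial>M) \<noteq> \<infinity>" by simp
  then have "AE x in M. (\<Sum>i. ennreal (2^i * (d i x)\<^sup>2)) \<noteq> \<infinity>"
    by (intro nn_integral_noteq_infinite) measurable
  then have conv: "AE x in M. convergent (\<lambda>i. w (r i) x)"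
  proof eventually_elim
    fix x assume "(\<Sum>i. ennreal (2^i * (d i x)\<^sup>2)) \<noteq> \<infinity>"
    then have s1: "summable (\<lambda>i. 2^i * (d i x)\<^sup>2)"
      by (intro summable_suminf_not_top) (auto simp: infinity_ennreal_def)
    have "summable (\<lambda>i. d i x)"
    proof (rule summable_comparison_test')
      show "summable (\<lambda>i. (1/2)^i + 2^i * (d i x)\<^sup>2)"
        by (intro summable_add s1 summable_geometric) simp
      fix i :: nat
      have "0 \<le> (1 - 2^i * \<bar>d i x\<bar>)\<^sup>2" by simp
      then have "2 * (2^i * \<bar>d i x\<bar>) \<le> 1 + 2^i * 2^i * (d i x)\<^sup>2"
        by (simp add: power2_eq_square algebra_simps)
      moreover have "0 \<le> 2^i * \<bar>d i x\<bar>" by simp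
      ultimately have "2^i * \<bar>d i x\<bar> \<le> 1 + 2^i * 2^i * (d i x)\<^sup>2" by linarith
      then show "norm (d i x) \<le> (1/2)^i + 2^i * (d i x)\<^sup>2"
        by (simp add: field_simps power_one_over)
    qed
    then have "convergent (\<lambda>n. \<Sum>i<n. d i x)" by (simp add: summable_iff_convergent)
    then have "convergent (\<lambda>n. w (r 0) x + (\<Sum>i<n. d i x))" by (intro convergent_add convergent_const)
    moreover have "w (r 0) x + (\<Sum>i<n. d i x) = w (r n) x" for n
      by (simp add: d_def sum_lessThan_telescope[of "\<lambda>i. w (r i) x"])
    ultimately show "convergent (\<lambda>i. w (r i) x)" by simp
  qed
  define v where "v x = lim (\<lambda>i. w (r i) x)" for x
  have [measurable]: "v \<in> borel_measurable M" unfolding v_def by measurable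
  have lim: "AE x in M. (\<lambda>k. w (r k) x) \<longlonglongrightarrow> v x"
    using conv by eventually_elim (simp add: v_def convergent_LIMSEQ_iff)
  have fatou: "(\<integral>\<^sup>+x. ennreal ((w (r i) x - v x)\<^sup>2) \<partial>M) \<le> ennreal ((1/4)^i)" for i
  proof -
    have "(\<integral>\<^sup>+x. ennreal ((w (r i) x - v x)\<^sup>2) \<partial>M) =
        (\<integral>\<^sup>+x. liminf (\<lambda>j. ennreal ((w (r i) x - w (r j) x)\<^sup>2)) \<partial>M)"
    proof (rule nn_integral_cong_AE)
      show "AE x in M. ennreal ((w (r i) x - v x)\<^sup>2) = liminf (\<lambda>j. ennreal ((w (r i) x - w (r j) x)\<^sup>2))"
        using lim
      proof eventually_elim
        fix x assume "(\<lambda>k. w (r k) x) \<longlonglongrightarrow> v x"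
        then have "(\<lambda>j. ennreal ((w (r i) x - w (r j) x)\<^sup>2)) \<longlonglongrightarrow> ennreal ((w (r i) x - v x)\<^sup>2)"
          by (intro tendsto_intros)
        from lim_imp_Liminf[OF sequentially_bot this]
        show "ennreal ((w (r i) x - v x)\<^sup>2) = liminf (\<lambda>j. ennreal ((w (r i) x - w (r j) x)\<^sup>2))"
          by (rule sym)
      qed
    qed
    also have "\<dots> \<le> liminf (\<lambda>j. \<integral>\<^sup>+x. ennreal ((w (r i) x - w (r j) x)\<^sup>2) \<partial>M)"
      by (rule nn_integral_liminf) measurable
    also have "\<dots> \<le> limsup (\<lambda>j. \<integral>\<^sup>+x. ennreal ((w (r i) x - w (r j) x)\<^sup>2) \<partial>M)"
      by (rule Liminf_le_Limsup) simp
    also have "\<dots> \<le> ennreal ((1/4)^i)"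
      by (rule Limsup_bounded) (use small in \<open>auto simp: eventually_sequentially\<close>)
    finally show ?thesis .
  qed
  have ir: "integrable M (\<lambda>x. (w (r i) x - v x)\<^sup>2)" for i
  proof (rule integrableI_nonneg)
    show "(\<integral>\<^sup>+x. ennreal ((w (r i) x - v x)\<^sup>2) \<partial>M) < \<infinity>"
      using fatou[of i] by (rule order_le_less_trans) simp
  qed auto
  have "integrable M (\<lambda>x. (v x)\<^sup>2)"
  proof (rule Bochner_Integration.integrable_bound)
    show "integrable M (\<lambda>x. 2 * (w (r 0) x)\<^sup>2 + 2 * (w (r 0) x - v x)\<^sup>2)" using sq ir by simp
    show "AE x in M. norm ((v x)\<^sup>2) \<le> norm (2 * (w (r 0) x)\<^sup>2 + 2 * (w (r 0) x - v x)\<^sup>2)"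
    proof (intro AE_I2)
      fix x have "0 \<le> (2 * w (r 0) x - v x)\<^sup>2" by simp
      then have "(v x)\<^sup>2 \<le> 2 * (w (r 0) x)\<^sup>2 + 2 * (w (r 0) x - v x)\<^sup>2"
        by (simp add: power2_eq_square algebra_simps)
      then show "norm ((v x)\<^sup>2) \<le> norm (2 * (w (r 0) x)\<^sup>2 + 2 * (w (r 0) x - v x)\<^sup>2)"
        unfolding real_norm_def abs_power2 by (rule order_trans[OF _ abs_ge_self])
    qed
  qed simp
  moreover have "(\<lambda>k. LINT x|M. (w (r k) x - v x)\<^sup>2) \<longlonglongrightarrow> 0"
  proof (rule tendsto_sandwich[OF _ _ tendsto_const])
    show "(\<lambda>i. (1/4::real)^i) \<longlonglongrightarrow> 0" by (rule LIMSEQ_realpow_zero) auto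
    show "\<forall>\<^sub>F k in sequentially. 0 \<le> (LINT x|M. (w (r k) x - v x)\<^sup>2)" by simp
    have "(LINT x|M. (w (r k) x - v x)\<^sup>2) \<le> (1/4)^k" for k
      using fatou[of k] by (subst (asm) nn_integral_eq_integral[OF ir]) (auto simp: ennreal_le_iff)
    then show "\<forall>\<^sub>F k in sequentially. (LINT x|M. (w (r k) x - v x)\<^sup>2) \<le> (1/4)^k" by simp
  qed
  ultimately show thesis using mono lim ir that[of r v] by simp
qed

section \<open>Compact embedding\<close>

text \<open>
  Fatou's lemma: convergence almost everywhere of \<open>u k\<close> implies that of the Gagliardo integrands.
\<close>
lemma energy_lower_semicontinuous:
  fixes u :: "nat \<Rightarrow> real ^ 'n \<Rightarrow> real"
  assumes u: "\<And>k. u k \<in> dirichlet_space s \<Omega>" and [measurable]: "v \<in> borel_measurable borel"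
    and lim: "AE x in lborel. (\<lambda>k. u k x) \<longlonglongrightarrow> v x"
    and B: "\<forall>\<^sub>F k in sequentially. energy s (u k) \<le> B"
  shows "integrable lborel (gagliardo_integrand s v v)" and "energy s v \<le> B"
proof -
  note [measurable] = dirichlet_spaceD(1)[OF u]
  have "0 \<le> B" using B energy_nonneg[of s] by (metis (no_types, lifting) eventually_at_top_linorder order_refl order_trans)
  have "(\<integral>\<^sup>+z. ennreal (gagliardo_integrand s v v z) \<partial>lborel) =
      (\<integral>\<^sup>+z. liminf (\<lambda>k. ennreal (gagliardo_integrand s (u k) (u k) z)) \<partial>lborel)"
  proof (rule nn_integral_cong_AE)
    show "AE z in lborel. ennreal (gagliardo_integrand s v v z) = liminf (\<lambda>k. ennreal (gagliardo_integrand s (u k) (u k) z))"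
      using AE_lborel_prod[OF lim]
    proof eventually_elim
      fix z :: "(real ^ 'n) \<times> (real ^ 'n)"
      assume z: "(\<lambda>k. u k (fst z)) \<longlonglongrightarrow> v (fst z) \<and> (\<lambda>k. u k (snd z)) \<longlonglongrightarrow> v (snd z)"
      have "(\<lambda>k. gagliardo_integrand s (u k) (u k) z) \<longlonglongrightarrow> gagliardo_integrand s v v z"
        unfolding gagliardo_integrand_def case_prod_beta divide_inverse using z by (intro tendsto_intros) auto
      then have "(\<lambda>k. ennreal (gagliardo_integrand s (u k) (u k) z)) \<longlonglongrightarrow> ennreal (gagliardo_integrand s v v z)"
        by (rule tendsto_ennrealI)
      then show "ennreal (gagliardo_integrand s v v z) = liminf (\<lambda>k. ennreal (gagliardo_integrand s (u k) (u k) z))"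
        by (simp add: lim_imp_Liminf)
    qed
  qed
  also have "\<dots> \<le> liminf (\<lambda>k. \<integral>\<^sup>+z. ennreal (gagliardo_integrand s (u k) (u k) z) \<partial>lborel)"
    by (rule nn_integral_liminf) measurable
  also have "\<dots> = liminf (\<lambda>k. ennreal (energy s (u k)))"
    using dirichlet_spaceD(4)[OF u]
    by (simp add: nn_integral_eq_integral gagliardo_integrand_nonneg gagliardo_form_lborel)
  also have "\<dots> \<le> limsup (\<lambda>k. ennreal (energy s (u k)))" by (rule Liminf_le_Limsup) simp
  also have "\<dots> \<le> ennreal B"
    by (rule Limsup_bounded) (use B in \<open>auto elim!: eventually_mono intro: ennreal_leI\<close>)
  finally have le: "(\<integral>\<^sup>+z. ennreal (gagliardo_integrand s v v z) \<partial>lborel) \<le> ennreal B" .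
  show i: "integrable lborel (gagliardo_integrand s v v)"
  proof (rule integrableI_nonneg)
    show "(\<integral>\<^sup>+z. ennreal (gagliardo_integrand s v v z) \<partial>lborel) < \<infinity>"
      using le by (rule order_le_less_trans) simp
  qed (auto simp: gagliardo_integrand_nonneg)
  show "energy s v \<le> B"
    using le \<open>0 \<le> B\<close> by (simp add: nn_integral_eq_integral[OF i] gagliardo_integrand_nonneg gagliardo_form_lborel ennreal_le_iff)
qed

text \<open>
  The integrals of \<open>u k\<close> over all grid cells that meet \<open>\<Omega>\<close>, for all mesh sizes, form a countable family
  of uniformly bounded sequences, so a diagonal argument makes all of them converge. By
  \<open>grid_estimate\<close>, applied to differences, the subsequence is Cauchy in \<open>L\<^sup>2\<close>: a fine mesh makes the
  energy term small, and for that mesh only finitely many convergent averages remain.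
\<close>
lemma energy_bounded_L2_Cauchy_subsequence:
  fixes u :: "nat \<Rightarrow> real ^ 'n \<Rightarrow> real"
  assumes "bounded \<Omega>" and "open \<Omega>" and "0 < s"
    and u: "\<And>k. u k \<in> dirichlet_space s \<Omega>" and M: "\<And>k. energy s (u k) \<le> M"
  obtains r :: "nat \<Rightarrow> nat" where "strict_mono r"
    "\<forall>e>0. \<exists>K. \<forall>j\<ge>K. \<forall>k\<ge>K. (LINT x|lborel. (u (r j) x - u (r k) x)\<^sup>2) < e"
proof -
  note [measurable] = dirichlet_spaceD(1)[OF u]
  have [measurable]: "\<Omega> \<in> sets borel" using \<open>open \<Omega>\<close> by simp
  obtain C where C: "0 < C" "\<And>u. u \<in> dirichlet_space s \<Omega> \<Longrightarrow> (LINT x|lborel. (u x)\<^sup>2) \<le> C * energy s u"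
    using poincare_inequality[OF \<open>bounded \<Omega>\<close> \<open>0 < s\<close>] by metis
  define A where "A N = {a. grid_cell N a \<inter> \<Omega> \<noteq> {}}" for N
  have fA: "finite (A N)" for N unfolding A_def by (rule finite_grid_cells) fact
  define c where "c k = (\<lambda>(N, a). LINT x:grid_cell N a|lborel. u k x)" for k
  have finO: "emeasure lborel \<Omega> < \<infinity>" using emeasure_bounded_finite[OF \<open>bounded \<Omega>\<close>] by simp
  have bd: "\<bar>indicator Q x * u k x\<bar> \<le> indicator \<Omega> x + (u k x)\<^sup>2" for Q x k
  proof -
    have "0 \<le> (1 - \<bar>u k x\<bar>)\<^sup>2" by simp
    then have "2 * \<bar>u k x\<bar> \<le> 1 + (u k x)\<^sup>2" by (simp add: power2_eq_square algebra_simps)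
    moreover have "0 \<le> \<bar>u k x\<bar>" by simp
    ultimately have "\<bar>u k x\<bar> \<le> 1 + (u k x)\<^sup>2" by linarith
    then show ?thesis using dirichlet_spaceD(2)[OF u] by (auto simp: indicator_def abs_mult)
  qed
  have ib: "integrable lborel (\<lambda>x. indicator \<Omega> x + (u k x)\<^sup>2)" for k
    using dirichlet_spaceD(3)[OF u] finO by (intro Bochner_Integration.integrable_add integrable_real_indicator) auto
  have ii: "integrable lborel (\<lambda>x. indicator (grid_cell N a) x * u k x)" for N a k
  proof (rule Bochner_Integration.integrable_bound[OF ib[of k]])
    show "AE x in lborel. norm (indicator (grid_cell N a) x * u k x) \<le> norm (indicator \<Omega> x + (u k x)\<^sup>2)"
      using bd by (auto intro!: AE_I2 order_trans[OF bd])
  qed simp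
  have "norm (c k p) \<le> measure lborel \<Omega> + C * M" for k p
  proof -
    obtain N a where p: "p = (N, a)" by (cases p)
    have "norm (c k p) \<le> (LINT x|lborel. \<bar>indicator (grid_cell N a) x * u k x\<bar>)"
      by (simp add: c_def p set_lebesgue_integral_def)
    also have "\<dots> \<le> (LINT x|lborel. indicator \<Omega> x + (u k x)\<^sup>2)"
      by (rule integral_mono) (use ii ib bd in auto)
    also have "\<dots> = measure lborel \<Omega> + (LINT x|lborel. (u k x)\<^sup>2)"
      using dirichlet_spaceD(3)[OF u] finO by (subst Bochner_Integration.integral_add) auto
    also have "\<dots> \<le> measure lborel \<Omega> + C * M"
      using C(2)[OF u, of k] mult_left_mono[OF M[of k] less_imp_le[OF \<open>0 < C\<close>]] by linarith
    finally show ?thesis .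
  qed
  moreover have "countable (Sigma UNIV A)" by (intro countable_SIGMA countable_finite[OF fA]) simp
  ultimately obtain r where r: "strict_mono r" "\<And>p. p \<in> Sigma UNIV A \<Longrightarrow> \<exists>l. (\<lambda>k. c (r k) p) \<longlonglongrightarrow> l"
    using function_convergent_subsequence[of "Sigma UNIV A" c "measure lborel \<Omega> + C * M"] by blast
  define l where "l p = lim (\<lambda>k. c (r k) p)" for p
  have l: "(\<lambda>k. c (r k) (N, a)) \<longlonglongrightarrow> l (N, a)" if "a \<in> A N" for N a
    using r(2)[of "(N, a)"] that by (auto simp: l_def convergent_def[symmetric] convergent_LIMSEQ_iff)
  have "0 \<le> M" using M[of 0] energy_nonneg[of s "u 0"] by linarith
  show thesis
  proof (rule that[OF r(1)], intro allI impI)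
    fix e :: real assume "0 < e"
    \<comment> \<open>The factor \<open>4 * M\<close> bounds the energy of a difference of two members of the sequence.\<close>
    define b where "b = real CARD('n) powr (real CARD('n) + 2 * s) * (4 * M)"
    have "((\<lambda>N. b * real N powr (- (2 * s))) \<longlongrightarrow> b * 0) sequentially"
      using \<open>0 < s\<close> by (intro tendsto_intros tendsto_neg_powr filterlim_real_sequentially) auto
    then have "\<forall>\<^sub>F N in sequentially. b * real N powr (- (2 * s)) < e / 2"
      using \<open>0 < e\<close> by (intro order_tendstoD) auto
    then have "\<forall>\<^sub>F N in sequentially. b * real N powr (- (2 * s)) < e / 2 \<and> 0 < N"
      using eventually_gt_at_top[of 0] by eventually_elim simp
    then obtain N where N: "b * real N powr (- (2 * s)) < e / 2" "0 < N"
      by (auto simp: eventually_sequentially)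
    have "((\<lambda>p. real N ^ CARD('n) * (\<Sum>a\<in>A N. (c (r (fst p)) (N, a) - c (r (snd p)) (N, a))\<^sup>2)) \<longlongrightarrow>
        real N ^ CARD('n) * (\<Sum>a\<in>A N. (l (N, a) - l (N, a))\<^sup>2)) (sequentially \<times>\<^sub>F sequentially)"
      by (intro tendsto_intros filterlim_compose[OF l filterlim_fst] filterlim_compose[OF l filterlim_snd])
    then have "\<forall>\<^sub>F p in sequentially \<times>\<^sub>F sequentially.
        real N ^ CARD('n) * (\<Sum>a\<in>A N. (c (r (fst p)) (N, a) - c (r (snd p)) (N, a))\<^sup>2) < e / 2"
      using \<open>0 < e\<close> by (intro order_tendstoD) auto
    then obtain K where K: "\<And>j k. K \<le> j \<Longrightarrow> K \<le> k \<Longrightarrow>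
        real N ^ CARD('n) * (\<Sum>a\<in>A N. (c (r j) (N, a) - c (r k) (N, a))\<^sup>2) < e / 2"
      unfolding eventually_prod_sequentially by auto
    have "(LINT x|lborel. (u (r j) x - u (r k) x)\<^sup>2) < e" if "K \<le> j" "K \<le> k" for j k
    proof -
      define d where "d x = u (r j) x - u (r k) x" for x
      have d: "d \<in> dirichlet_space s \<Omega>" "energy s d \<le> 4 * M"
        using energy_diff_le[OF u[of "r j"] u[of "r k"]] M[of "r j"] M[of "r k"]
        unfolding d_def[abs_def] by (auto simp: algebra_simps)
      have "(LINT x:grid_cell N a|lborel. d x) = c (r j) (N, a) - c (r k) (N, a)" for a
        using ii by (simp add: c_def d_def set_lebesgue_integral_def right_diff_distrib)
      then have "(LINT x|lborel. (d x)\<^sup>2) \<le>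
         real N ^ CARD('n) * (\<Sum>a\<in>A N. (c (r j) (N, a) - c (r k) (N, a))\<^sup>2)
         + real CARD('n) powr (real CARD('n) + 2 * s) * real N powr (- (2 * s)) * energy s d"
        using grid_estimate[OF \<open>bounded \<Omega>\<close> \<open>0 < s\<close> N(2) d(1)] by (simp add: A_def)
      also have "real CARD('n) powr (real CARD('n) + 2 * s) * real N powr (- (2 * s)) * energy s d
          \<le> real CARD('n) powr (real CARD('n) + 2 * s) * real N powr (- (2 * s)) * (4 * M)"
        by (intro mult_left_mono d) auto
      also have "\<dots> < e / 2" using N(1) by (simp add: b_def mult_ac)
      finally show ?thesis using K[OF that] by (simp add: d_def)
    qed
    then show "\<exists>K. \<forall>j\<ge>K. \<forall>k\<ge>K. (LINT x|lborel. (u (r j) x - u (r k) x)\<^sup>2) < e" by blast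
  qed
qed

text \<open>
  The lower semicontinuity is stated for upper bounds that hold eventually, which is what the direct
  method consumes.
\<close>
lemma compact_embedding_L2:
  fixes u :: "nat \<Rightarrow> real ^ 'n \<Rightarrow> real"
  assumes "bounded \<Omega>" and "open \<Omega>" and "0 < s"
    and u: "\<And>k. u k \<in> dirichlet_space s \<Omega>" and M: "\<And>k. energy s (u k) \<le> M"
  obtains r :: "nat \<Rightarrow> nat" and v where "strict_mono r" "v \<in> dirichlet_space s \<Omega>"
    "(\<lambda>k. LINT x|lborel. (u (r k) x - v x)\<^sup>2) \<longlonglongrightarrow> 0"
    "\<forall>B. (\<forall>\<^sub>F k in sequentially. energy s (u (r k)) \<le> B) \<longrightarrow> energy s v \<le> B"
proof -
  note [measurable] = dirichlet_spaceD(1)[OF u]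
  have [measurable]: "\<Omega> \<in> sets borel" using \<open>open \<Omega>\<close> by simp
  obtain r :: "nat \<Rightarrow> nat" where r: "strict_mono r"
    "\<forall>e>0. \<exists>K. \<forall>j\<ge>K. \<forall>k\<ge>K. (LINT x|lborel. (u (r j) x - u (r k) x)\<^sup>2) < e"
    by (rule energy_bounded_L2_Cauchy_subsequence[where u = u, OF assms(1-3) u M])
  obtain r' w where w: "strict_mono r'" "w \<in> borel_measurable lborel" "integrable lborel (\<lambda>x. (w x)\<^sup>2)"
    "AE x in lborel. (\<lambda>k. u (r (r' k)) x) \<longlonglongrightarrow> w x"
    "\<And>k. integrable lborel (\<lambda>x. (u (r (r' k)) x - w x)\<^sup>2)"
    "(\<lambda>k. LINT x|lborel. (u (r (r' k)) x - w x)\<^sup>2) \<longlonglongrightarrow> 0"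
    by (rule L2_Cauchy_converging_subsequence[of "\<lambda>k. u (r k)" lborel])
       (use r(2) dirichlet_spaceD(3)[OF u] in auto)
  have [measurable]: "w \<in> borel_measurable borel" using w(2) by simp
  define v where "v x = indicator \<Omega> x * w x" for x
  have vm [measurable]: "v \<in> borel_measurable borel" unfolding v_def by measurable
  have vw: "AE x in lborel. w x = v x"
    using w(4)
  proof eventually_elim
    fix x assume lim: "(\<lambda>k. u (r (r' k)) x) \<longlonglongrightarrow> w x"
    show "w x = v x"
    proof (cases "x \<in> \<Omega>")
      case False
      then have "w x = 0" using lim dirichlet_spaceD(2)[OF u] by (simp add: LIMSEQ_const_iff)
      then show ?thesis by (simp add: v_def)
    qed (simp add: v_def)
  qed
  have lim: "AE x in lborel. (\<lambda>k. u ((r \<circ> r') k) x) \<longlonglongrightarrow> v x"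
    using w(4) vw by eventually_elim simp
  note lsc = energy_lower_semicontinuous[of "\<lambda>k. u ((r \<circ> r') k)", OF u vm lim]
  have "integrable lborel (\<lambda>x. (v x)\<^sup>2)"
  proof (rule Bochner_Integration.integrable_bound[OF w(3)])
    show "AE x in lborel. norm ((v x)\<^sup>2) \<le> norm ((w x)\<^sup>2)" by (auto simp: v_def indicator_def)
  qed simp
  moreover have "integrable lborel (gagliardo_integrand s v v)"
    by (rule lsc(1)[of M]) (simp add: M)
  ultimately have "v \<in> dirichlet_space s \<Omega>"
    by (auto simp: dirichlet_space_def) (auto simp: v_def)
  moreover have "(LINT x|lborel. (u ((r \<circ> r') k) x - v x)\<^sup>2) = (LINT x|lborel. (u (r (r' k)) x - w x)\<^sup>2)" for k
  proof (rule integral_cong_AE)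
    show "AE x in lborel. (u ((r \<circ> r') k) x - v x)\<^sup>2 = (u (r (r' k)) x - w x)\<^sup>2"
      using vw by eventually_elim simp
  qed auto
  ultimately show thesis using that[of "r \<circ> r'" v] strict_mono_o[OF r(1) w(1)] w(6) lsc(2) by simp
qed

section \<open>Superposition operators of quadratic growth\<close>

lemma set_integrable_superposition:
  fixes v :: "'a::euclidean_space \<Rightarrow> real"
  assumes [measurable]: "\<Omega> \<in> sets borel" "v \<in> borel_measurable borel"
    and cont: "continuous_on UNIV G"
    and fin: "emeasure lborel \<Omega> < \<infinity>"
    and growth: "\<And>a b. \<bar>G a - G b\<bar> \<le> K * ((1 + \<bar>b\<bar> + \<bar>a - b\<bar>) * \<bar>a - b\<bar>)" and "0 \<le> K"
    and v2: "integrable lborel (\<lambda>x. (v x)\<^sup>2)"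
  shows "set_integrable lborel \<Omega> (\<lambda>x. G (v x))"
proof -
  have [measurable]: "G \<in> borel_measurable borel" using cont by (rule borel_measurable_continuous_onI)
  have i1: "integrable lborel (\<lambda>x. indicator \<Omega> x :: real)" using fin by (intro integrable_real_indicator) auto
  show ?thesis
    unfolding set_integrable_def real_scaleR_def
  proof (rule Bochner_Integration.integrable_bound)
    show "integrable lborel (\<lambda>x. (\<bar>G 0\<bar> + 2 * K) * indicator \<Omega> x + 2 * K * (v x)\<^sup>2)"
      using i1 v2 by simp
    show "AE x in lborel. norm (indicator \<Omega> x * G (v x)) \<le> norm ((\<bar>G 0\<bar> + 2 * K) * indicator \<Omega> x + 2 * K * (v x)\<^sup>2)"
    proof (intro AE_I2)
      fix x
      have "0 \<le> (1 - \<bar>v x\<bar>)\<^sup>2" by simp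
      then have "(1 + \<bar>v x\<bar>) * \<bar>v x\<bar> \<le> 2 * (1 + (v x)\<^sup>2)" 
        using zero_le_power2[of "v x"] by (simp add: power2_eq_square algebra_simps)
      then have "K * ((1 + \<bar>v x\<bar>) * \<bar>v x\<bar>) \<le> K * (2 * (1 + (v x)\<^sup>2))" 
        using \<open>0 \<le> K\<close> by (rule mult_left_mono)
      moreover have "\<bar>G (v x) - G 0\<bar> \<le> K * ((1 + \<bar>v x\<bar>) * \<bar>v x\<bar>)" using growth[of "v x" 0] by simp
      ultimately have "\<bar>G (v x)\<bar> \<le> (\<bar>G 0\<bar> + 2 * K) + 2 * K * (v x)\<^sup>2"
        by (simp add: algebra_simps)
      then show "norm (indicator \<Omega> x * G (v x)) \<le> norm ((\<bar>G 0\<bar> + 2 * K) * indicator \<Omega> x + 2 * K * (v x)\<^sup>2)"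
        by (auto simp: indicator_def)
    qed
  qed measurable
qed

text \<open>
  Writing \<open>t = \<bar>w k x - v x\<bar>\<close>, Young's inequality splits the growth bound into
  \<open>K \<eta> (1 + (v x)\<^sup>2)\<close>, whose integral over \<open>\<Omega>\<close> is as small as desired, and a multiple of \<open>t\<^sup>2\<close>, whose
  integral tends to \<open>0\<close> for fixed \<open>\<eta>\<close>.
\<close>
lemma integral_superposition_tendsto:
  fixes w :: "nat \<Rightarrow> 'a::euclidean_space \<Rightarrow> real"
  assumes [measurable]: "\<Omega> \<in> sets borel" "v \<in> borel_measurable borel" "\<And>k. w k \<in> borel_measurable borel"
    and cont: "continuous_on UNIV G"
    and fin: "emeasure lborel \<Omega> < \<infinity>"
    and growth: "\<And>a b. \<bar>G a - G b\<bar> \<le> K * ((1 + \<bar>b\<bar> + \<bar>a - b\<bar>) * \<bar>a - b\<bar>)" and "0 \<le> K"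
    and v2: "integrable lborel (\<lambda>x. (v x)\<^sup>2)" and w2: "\<And>k. integrable lborel (\<lambda>x. (w k x)\<^sup>2)"
    and conv: "(\<lambda>k. LINT x|lborel. (w k x - v x)\<^sup>2) \<longlonglongrightarrow> 0"
  shows "(\<lambda>k. LINT x:\<Omega>|lborel. G (w k x)) \<longlonglongrightarrow> (LINT x:\<Omega>|lborel. G (v x))"
proof (rule tendstoI)
  fix e :: real assume "0 < e"
  have [measurable]: "G \<in> borel_measurable borel" using cont by (rule borel_measurable_continuous_onI)
  have i1: "integrable lborel (\<lambda>x. indicator \<Omega> x :: real)" using fin by (intro integrable_real_indicator) auto
  have d2: "integrable lborel (\<lambda>x. (w k x - v x)\<^sup>2)" for k
  proof -
    have "integrable lborel (\<lambda>x. (w k x)\<^sup>2 - 2 * (w k x * v x) + (v x)\<^sup>2)"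
      by (intro Bochner_Integration.integrable_add Bochner_Integration.integrable_diff
          integrable_mult_right integrable_mult_of_squares v2 w2) auto
    moreover have "(\<lambda>x. (w k x)\<^sup>2 - 2 * (w k x * v x) + (v x)\<^sup>2) = (\<lambda>x. (w k x - v x)\<^sup>2)"
      by (auto simp: power2_eq_square algebra_simps)
    ultimately show ?thesis by simp
  qed
  note gi = set_integrable_superposition[OF assms(1) _ cont fin growth \<open>0 \<le> K\<close>]
  have gw: "integrable lborel (\<lambda>x. indicator \<Omega> x * G (w k x))" for k
    using gi[of "w k"] w2 by (simp add: set_integrable_def)
  have gv: "integrable lborel (\<lambda>x. indicator \<Omega> x * G (v x))"
    using gi[of v] v2 by (simp add: set_integrable_def)
  define D where "D = measure lborel \<Omega> + (LINT x|lborel. (v x)\<^sup>2)"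
  have "0 \<le> D" unfolding D_def by (intro add_nonneg_nonneg Bochner_Integration.integral_nonneg) auto
  \<comment> \<open>This choice makes \<open>K * (\<eta> * D) < e / 2\<close>; the summand \<open>1\<close> covers the case \<open>K * D = 0\<close>.\<close>
  define \<eta> where "\<eta> = e / (2 * (K * D + 1))"
  have "0 < K * D + 1" using \<open>0 \<le> K\<close> \<open>0 \<le> D\<close> by (simp add: add_nonneg_pos)
  then have \<eta>: "0 < \<eta>" "K * (\<eta> * D) < e / 2" 
    using \<open>0 < e\<close> \<open>0 \<le> K\<close> by (auto simp: \<eta>_def field_simps)
  define L where "L = K * (1 + 1 / \<eta>)"
  have pt: "\<bar>indicator \<Omega> x * G (w k x) - indicator \<Omega> x * G (v x)\<bar>
     \<le> K * \<eta> * (indicator \<Omega> x + (v x)\<^sup>2) + L * (w k x - v x)\<^sup>2" for k x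
  proof -
    define t b where "t = \<bar>w k x - v x\<bar>" and "b = \<bar>v x\<bar>"
    have "0 \<le> t" "0 \<le> b" by (auto simp: t_def b_def)
    have "0 \<le> (\<eta> * (1 + b) - t)\<^sup>2" "0 \<le> \<eta>\<^sup>2 * (1 - b)\<^sup>2" by auto
    then have "2 * \<eta> * ((1 + b) * t) \<le> \<eta>\<^sup>2 * (2 * (1 + b\<^sup>2)) + t\<^sup>2"
      by (simp add: power2_eq_square algebra_simps)
    also have "\<dots> = 2 * \<eta> * (\<eta> * (1 + b\<^sup>2) + t\<^sup>2 / (2 * \<eta>))"
      using \<eta>(1) by (simp add: power2_eq_square field_simps)
    finally have "(1 + b) * t \<le> \<eta> * (1 + b\<^sup>2) + t\<^sup>2 / (2 * \<eta>)" 
      by (rule mult_left_le_imp_le) (use \<eta> in simp)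
    moreover have "t\<^sup>2 / (2 * \<eta>) \<le> t\<^sup>2 / \<eta>" using \<eta> by (simp add: field_simps)
    ultimately have "(1 + b + t) * t \<le> \<eta> * (1 + b\<^sup>2) + (1 + 1 / \<eta>) * t\<^sup>2"
      by (simp add: power2_eq_square algebra_simps)
    then have "K * ((1 + b + t) * t) \<le> K * (\<eta> * (1 + b\<^sup>2) + (1 + 1 / \<eta>) * t\<^sup>2)"
      using \<open>0 \<le> K\<close> by (rule mult_left_mono)
    then have "\<bar>G (w k x) - G (v x)\<bar> \<le> K * \<eta> * (1 + b\<^sup>2) + L * t\<^sup>2"
      using growth[of "w k x" "v x"] by (simp add: t_def b_def L_def algebra_simps)
    moreover have "0 \<le> K * \<eta> * b\<^sup>2 + L * t\<^sup>2" 
      using \<eta> \<open>0 \<le> K\<close> by (auto simp: L_def)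
    ultimately show ?thesis
      by (auto simp: indicator_def t_def b_def)
  qed
  have "((\<lambda>k. L * (LINT x|lborel. (w k x - v x)\<^sup>2)) \<longlongrightarrow> L * 0) sequentially"
    by (intro tendsto_intros conv)
  then have "\<forall>\<^sub>F k in sequentially. L * (LINT x|lborel. (w k x - v x)\<^sup>2) < e / 2"
    using \<open>0 < e\<close> by (intro order_tendstoD) auto
  then show "\<forall>\<^sub>F k in sequentially. dist (LINT x:\<Omega>|lborel. G (w k x)) (LINT x:\<Omega>|lborel. G (v x)) < e"
  proof eventually_elim
    fix k assume k: "L * (LINT x|lborel. (w k x - v x)\<^sup>2) < e / 2"
    have "dist (LINT x:\<Omega>|lborel. G (w k x)) (LINT x:\<Omega>|lborel. G (v x)) =
      \<bar>LINT x|lborel. indicator \<Omega> x * G (w k x) - indicator \<Omega> x * G (v x)\<bar>"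
      by (simp add: dist_real_def set_lebesgue_integral_def gw gv)
    also have "\<dots> \<le> (LINT x|lborel. K * \<eta> * (indicator \<Omega> x + (v x)\<^sup>2) + L * (w k x - v x)\<^sup>2)"
      by (rule Bochner_Integration.integral_abs_bound[THEN order_trans], rule integral_mono)
         (use gw gv i1 v2 d2 pt in auto)
    also have "\<dots> = K * (\<eta> * D) + L * (LINT x|lborel. (w k x - v x)\<^sup>2)"
      using i1 v2 d2 fin by (simp add: D_def)
    also have "\<dots> < e" using k \<eta>(2) by simp
    finally show "dist (LINT x:\<Omega>|lborel. G (w k x)) (LINT x:\<Omega>|lborel. G (v x)) < e" .
  qed
qed

section \<open>Existence of a non-zero function of finite energy\<close>

lemma geometric_ennreal_sum_finite:
  fixes c x :: real
  assumes "0 \<le> c" "0 \<le> x" "x < 1"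
  shows "(\<Sum>j. ennreal (c * x ^ j)) < \<infinity>"
proof -
  have "(\<Sum>j. ennreal (c * x ^ j)) = ennreal (\<Sum>j. c * x ^ j)"
    using assms by (intro suminf_ennreal2) (auto intro!: summable_mult summable_geometric)
  then show ?thesis by simp
qed

lemma two_powr_mult_nat: "(2::real) powr (a * real j) = (2 powr a) ^ j"
  by (subst powr_powr[symmetric], subst powr_realpow) simp_all

text \<open>
  Dyadic shells. On \<open>2^m \<le> norm z < 2^(m+1)\<close> the kernel is bounded by a constant, and the shell lies in a
  ball of volume proportional to \<open>2^(m n)\<close>. For \<open>m \<ge> 0\<close> the bound \<open>c\<^sup>2\<close> of the numerator gives a
  geometric series of ratio \<open>2 powr (- 2 s)\<close>; for \<open>m < 0\<close> the bound \<open>(norm z)\<^sup>2\<close> gives ratio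
  \<open>2 powr (2 s - 2)\<close>. Both ratios are below \<open>1\<close> since \<open>0 < s < 1\<close>.
\<close>
lemma nn_integral_singular_kernel_finite:
  assumes "0 < s" "s < 1"
  shows "(\<integral>\<^sup>+z. ennreal (min (c\<^sup>2) ((norm z)\<^sup>2) / norm (z :: real ^ 'n) powr (real CARD('n) + 2 * s)) \<partial>lborel) < \<infinity>"
proof -
  define n where "n = real CARD('n)"
  define p where "p = n + 2 * s"
  define V where "V = unit_ball_vol n"
  have "0 < p" using assms by (simp add: p_def n_def add_nonneg_pos)
  have V: "0 \<le> V" by (simp add: V_def n_def)
  have ball: "emeasure lborel (ball (0 :: real ^ 'n) (2 powr t)) = ennreal (V * 2 powr (t * n))" for t
    by (subst emeasure_ball) (simp_all only: V_def n_def two_powr_mult_nat DIM_cart DIM_real mult_1_right powr_ge_zero)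
  \<comment> \<open>\<open>far j\<close> dominates the kernel on the shell with \<open>m = j\<close>, \<open>near j\<close> on the one with \<open>m = - j - 1\<close>.\<close>
  define far :: "nat \<Rightarrow> real ^ 'n \<Rightarrow> ennreal" where
    "far j z = ennreal (c\<^sup>2 * 2 powr (- (j * p))) * indicator (ball 0 (2 powr (j + 1))) z" for j z
  define near :: "nat \<Rightarrow> real ^ 'n \<Rightarrow> ennreal" where
    "near j z = ennreal (2 powr (- 2 * j) * 2 powr ((j + 1) * p)) * indicator (ball 0 (2 powr (- real j))) z" for j z
  have [measurable]: "far j \<in> borel_measurable borel" "near j \<in> borel_measurable borel" for j
    unfolding far_def[abs_def] near_def[abs_def]
    by (intro borel_measurable_times_ennreal borel_measurable_indicator borel_measurable_const; simp)+
  have far_int: "(\<integral>\<^sup>+z. far j z \<partial>lborel) = ennreal (c\<^sup>2 * V * 2 powr n * (2 powr (- (2 * s))) ^ j)" for j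
  proof -
    have "(\<integral>\<^sup>+z. far j z \<partial>lborel) = ennreal (c\<^sup>2 * 2 powr (- (j * p)) * (V * 2 powr ((j + 1) * n)))"
      unfolding far_def using V by (subst nn_integral_cmult_indicator) (auto simp: ball ennreal_mult add.commute)
    also have "c\<^sup>2 * 2 powr (- (j * p)) * (V * 2 powr ((j + 1) * n)) =
        c\<^sup>2 * V * (2 powr (- (j * p) + (j + 1) * n))" by (simp only: powr_add mult_ac)
    also have "- (j * p) + (j + 1) * n = n + (- (2 * s)) * j" by (simp add: p_def algebra_simps)
    also have "2 powr (n + (- (2 * s)) * j) = 2 powr n * (2 powr (- (2 * s))) ^ j"
      by (simp only: powr_add two_powr_mult_nat)
    finally show ?thesis by (simp add: mult.assoc)
  qed
  have near_int: "(\<integral>\<^sup>+z. near j z \<partial>lborel) = ennreal (V * 2 powr p * (2 powr (2 * s - 2)) ^ j)" for j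
  proof -
    have "(\<integral>\<^sup>+z. near j z \<partial>lborel) = ennreal (2 powr (- 2 * j) * 2 powr ((j + 1) * p) * (V * 2 powr (- real j * n)))"
      unfolding near_def using V by (subst nn_integral_cmult_indicator) (auto simp: ball ennreal_mult add.commute)
    also have "2 powr (- 2 * j) * 2 powr ((j + 1) * p) * (V * 2 powr (- real j * n)) =
        V * (2 powr (- 2 * j + (j + 1) * p + (- real j * n)))" by (simp only: powr_add mult_ac)
    also have "- 2 * j + (j + 1) * p + (- real j * n) = p + (2 * s - 2) * j" by (simp add: p_def algebra_simps)
    also have "2 powr (p + (2 * s - 2) * j) = 2 powr p * (2 powr (2 * s - 2)) ^ j"
      by (simp only: powr_add two_powr_mult_nat)
    finally show ?thesis by (simp add: mult.assoc)
  qed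
  have pt: "ennreal (min (c\<^sup>2) ((norm z)\<^sup>2) / norm z powr p) \<le> (\<Sum>j. far j z) + (\<Sum>j. near j z)" for z :: "real ^ 'n"
  proof (cases "z = 0")
    case False
    define m where "m = \<lfloor>log 2 (norm z)\<rfloor>"
    have "0 < norm z" using False by simp
    then have nz: "norm z = 2 powr (log 2 (norm z))" by simp
    have m: "real_of_int m \<le> log 2 (norm z)" "log 2 (norm z) < real_of_int m + 1"
      unfolding m_def by linarith+
    have lo: "2 powr m \<le> norm z" and hi: "norm z < 2 powr (m + 1)"
      by (subst nz, use m in simp)+
    have inv: "2 powr (m * p) \<le> norm z powr p"
      using powr_mono2[of p "2 powr m" "norm z"] lo \<open>0 < p\<close> by (simp add: powr_powr)
    show ?thesis
    proof (cases "0 \<le> m")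
      case True
      define j where "j = nat m"
      have j: "real_of_int m = real j" using True by (simp add: j_def)
      have "min (c\<^sup>2) ((norm z)\<^sup>2) / norm z powr p \<le> c\<^sup>2 / 2 powr (j * p)"
        using inv by (intro frac_le) (auto simp: j)
      also have "\<dots> = c\<^sup>2 * 2 powr (- (j * p))" by (simp add: powr_minus divide_inverse)
      finally have "ennreal (min (c\<^sup>2) ((norm z)\<^sup>2) / norm z powr p) \<le> far j z"
        using hi by (auto simp: far_def j add.commute intro: ennreal_leI)
      also have "\<dots> \<le> (\<Sum>j. far j z)" using sum_le_suminf[of "\<lambda>j. far j z" "{j}"] by simp
      also have "\<dots> \<le> (\<Sum>j. far j z) + (\<Sum>j. near j z)" by simp
      finally show ?thesis .
    next
      case False
      define j where "j = nat (- m - 1)"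
      have j: "real_of_int m = - real j - 1" using False by (simp add: j_def)
      have e: "real_of_int m * p = - ((j + 1) * p)" by (simp add: j algebra_simps)
      have "(norm z)\<^sup>2 \<le> (2 powr (- real j))\<^sup>2" using hi by (intro power_mono) (auto simp: j)
      also have "\<dots> = 2 powr (- 2 * j)" by (simp add: power2_eq_square powr_add[symmetric])
      finally have "min (c\<^sup>2) ((norm z)\<^sup>2) / norm z powr p \<le> 2 powr (- 2 * j) / 2 powr (- ((j + 1) * p))"
        using inv unfolding e by (intro frac_le) auto
      also have "\<dots> = 2 powr (- 2 * j) * 2 powr ((j + 1) * p)" by (simp add: powr_minus divide_inverse)
      finally have "ennreal (min (c\<^sup>2) ((norm z)\<^sup>2) / norm z powr p) \<le> near j z"
        using hi by (auto simp: near_def j add.commute intro: ennreal_leI)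
      also have "\<dots> \<le> (\<Sum>j. near j z)" using sum_le_suminf[of "\<lambda>j. near j z" "{j}"] by simp
      also have "\<dots> \<le> (\<Sum>j. far j z) + (\<Sum>j. near j z)" by simp
      finally show ?thesis .
    qed
  qed simp
  have "(\<integral>\<^sup>+z. ennreal (min (c\<^sup>2) ((norm z)\<^sup>2) / norm (z :: real ^ 'n) powr p) \<partial>lborel)
      \<le> (\<integral>\<^sup>+z. (\<Sum>j. far j z) + (\<Sum>j. near j z) \<partial>lborel)"
    by (intro nn_integral_mono pt)
  also have "\<dots> = (\<Sum>j. \<integral>\<^sup>+z. far j z \<partial>lborel) + (\<Sum>j. \<integral>\<^sup>+z. near j z \<partial>lborel)"
    by (simp add: nn_integral_add nn_integral_suminf)
  also have "\<dots> < \<infinity>"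
  proof -
    have "(2::real) powr (- (2 * s)) < 2 powr 0" "(2::real) powr (2 * s - 2) < 2 powr 0"
      by (rule powr_less_mono; use assms in simp)+
    then have "(\<Sum>j. ennreal (c\<^sup>2 * V * 2 powr n * (2 powr (- (2 * s))) ^ j)) < \<infinity>"
      "(\<Sum>j. ennreal (V * 2 powr p * (2 powr (2 * s - 2)) ^ j)) < \<infinity>"
      using V by (intro geometric_ennreal_sum_finite; simp)+
    then show ?thesis
      unfolding far_int near_int infinity_ennreal_def ennreal_add_less_top by (rule conjI)
  qed
  finally show ?thesis unfolding p_def n_def .
qed

text \<open>
  The cone \<open>max 0 (r - dist p x)\<close> on a ball \<open>B\<close> in \<open>\<Omega>\<close> is bounded by \<open>r\<close> and \<open>1\<close>-Lipschitz, so its Gagliardo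
  integrand is at most the singular kernel in \<open>x - y\<close>, and vanishes unless \<open>x\<close> or \<open>y\<close> lies in \<open>B\<close>. By
  translation invariance the double integral is at most twice the volume of \<open>B\<close> times the integral of
  the kernel.
\<close>
lemma dirichlet_space_nontrivial:
  fixes \<Omega> :: "(real ^ 'n) set"
  assumes "0 < s" "s < 1" "open \<Omega>" "\<Omega> \<noteq> {}"
  obtains u where "u \<in> dirichlet_space s \<Omega>" "0 < (LINT x|lborel. (u x)\<^sup>2)"
proof -
  obtain p r where r: "0 < r" "ball p r \<subseteq> \<Omega>"
    using assms(3,4) by (meson ex_in_conv open_contains_ball)
  define B where "B = ball p r"
  have [measurable]: "B \<in> sets borel" by (simp add: B_def)
  define u where "u x = max 0 (r - dist p x)" for x
  have um [measurable]: "u \<in> borel_measurable borel" unfolding u_def by measurable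
  have u0: "u x = 0" if "x \<notin> B" for x using that by (simp add: u_def B_def)
  have ur: "0 \<le> u x" "u x \<le> r" for x using r by (auto simp: u_def)
  have lip: "\<bar>u x - u y\<bar> \<le> norm (x - y)" for x y
    using dist_triangle[of p y x] dist_triangle[of p x y] unfolding u_def
    by (auto simp: dist_norm[of x y] dist_commute[of y x] max_def abs_if)
  have finB: "emeasure lborel B < \<infinity>" unfolding B_def by (rule emeasure_lborel_ball_finite)
  define k where "k z = min (r\<^sup>2) ((norm z)\<^sup>2) / norm z powr (real CARD('n) + 2 * s)" for z :: "real ^ 'n"
  have [measurable]: "k \<in> borel_measurable borel" unfolding k_def by measurable
  have k_fin: "(\<integral>\<^sup>+z. ennreal (k z) \<partial>lborel) < \<infinity>"
    unfolding k_def by (rule nn_integral_singular_kernel_finite) fact+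
  have k_transl: "(\<integral>\<^sup>+y. ennreal (k (y - x)) \<partial>lborel) = (\<integral>\<^sup>+z. ennreal (k z) \<partial>lborel)" for x
  proof -
    have "(\<integral>\<^sup>+z. ennreal (k z) \<partial>lborel) = (\<integral>\<^sup>+z. ennreal (k z) \<partial>(distr lborel borel ((+) (- x))))"
      by (simp only: lborel_distr_plus)
    also have "\<dots> = (\<integral>\<^sup>+y. ennreal (k (y - x)) \<partial>lborel)"
      by (subst nn_integral_distr) auto
    finally show ?thesis ..
  qed
  have k_sym: "k (x - y) = k (y - x)" for x y by (simp add: k_def norm_minus_commute)
  have pt: "ennreal (gagliardo_integrand s u u (x, y))
      \<le> indicator B x * ennreal (k (x - y)) + indicator B y * ennreal (k (x - y))" for x y
  proof (cases "x \<in> B \<or> y \<in> B")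
    case True
    have "(u x - u y)\<^sup>2 \<le> (norm (x - y))\<^sup>2" using lip by (metis abs_ge_zero power2_abs power_mono)
    moreover have "\<bar>u x - u y\<bar> \<le> r" using ur[of x] ur[of y] by linarith
    then have "(u x - u y)\<^sup>2 \<le> r\<^sup>2" using r by (metis abs_ge_zero power2_abs power_mono)
    ultimately have "gagliardo_integrand s u u (x, y) \<le> k (x - y)"
      by (auto simp: gagliardo_integrand_def k_def power2_eq_square intro!: divide_right_mono)
    then have "ennreal (gagliardo_integrand s u u (x, y)) \<le> ennreal (k (x - y))" by (rule ennreal_leI)
    moreover have "ennreal (k (x - y)) \<le> indicator B x * ennreal (k (x - y)) + indicator B y * ennreal (k (x - y))"
      using True by (auto simp: indicator_def)
    ultimately show ?thesis by (rule order_trans)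
  qed (simp add: u0 gagliardo_integrand_def)
  have "(\<integral>\<^sup>+z. ennreal (gagliardo_integrand s u u z) \<partial>lborel) =
     (\<integral>\<^sup>+z. ennreal (gagliardo_integrand s u u z) \<partial>(lborel \<Otimes>\<^sub>M lborel))" by (simp only: lborel_prod)
  also have "\<dots> \<le> (\<integral>\<^sup>+z. indicator B (fst z) * ennreal (k (fst z - snd z))
     + indicator B (snd z) * ennreal (k (fst z - snd z)) \<partial>(lborel \<Otimes>\<^sub>M lborel))"
    by (intro nn_integral_mono) (use pt in \<open>metis prod.collapse\<close>)
  also have "\<dots> = (\<integral>\<^sup>+z. indicator B (fst z) * ennreal (k (fst z - snd z)) \<partial>(lborel \<Otimes>\<^sub>M lborel))
      + (\<integral>\<^sup>+z. indicator B (snd z) * ennreal (k (fst z - snd z)) \<partial>(lborel \<Otimes>\<^sub>M lborel))"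
    by (rule nn_integral_add) measurable
  also have "(\<integral>\<^sup>+z. indicator B (fst z) * ennreal (k (fst z - snd z)) \<partial>(lborel \<Otimes>\<^sub>M lborel))
      = (\<integral>\<^sup>+x. \<integral>\<^sup>+y. indicator B x * ennreal (k (y - x)) \<partial>lborel \<partial>lborel)"
    by (subst lborel.nn_integral_fst[symmetric]) (auto simp: k_sym intro!: nn_integral_cong)
  also have "\<dots> = (\<integral>\<^sup>+z. ennreal (k z) \<partial>lborel) * emeasure lborel B"
    by (simp add: nn_integral_cmult k_transl nn_integral_multc mult.commute)
  also have "(\<integral>\<^sup>+z. indicator B (snd z) * ennreal (k (fst z - snd z)) \<partial>(lborel \<Otimes>\<^sub>M lborel))
      = (\<integral>\<^sup>+y. \<integral>\<^sup>+x. indicator B y * ennreal (k (x - y)) \<partial>lborel \<partial>lborel)"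
    by (subst lborel_pair.nn_integral_snd[symmetric]) (auto simp: case_prod_beta)
  also have "\<dots> = (\<integral>\<^sup>+z. ennreal (k z) \<partial>lborel) * emeasure lborel B"
    by (simp add: nn_integral_cmult k_transl nn_integral_multc mult.commute)
  also have "(\<integral>\<^sup>+z. ennreal (k z) \<partial>lborel) * emeasure lborel B + (\<integral>\<^sup>+z. ennreal (k z) \<partial>lborel) * emeasure lborel B < \<infinity>"
    using k_fin finB by (simp add: ennreal_mult_less_top)
  finally have "integrable lborel (gagliardo_integrand s u u)"
    by (intro integrableI_nonneg) (auto simp: gagliardo_integrand_nonneg)
  moreover have u2: "integrable lborel (\<lambda>x. (u x)\<^sup>2)"
  proof (rule Bochner_Integration.integrable_bound)
    show "integrable lborel (\<lambda>x. r\<^sup>2 * indicator B x)" using finB by simp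
    show "AE x in lborel. norm ((u x)\<^sup>2) \<le> norm (r\<^sup>2 * indicator B x)"
      using ur by (auto simp: indicator_def u0 intro!: power_mono)
  qed simp
  moreover have "u x = 0" if "x \<notin> \<Omega>" for x
    using that r(2) u0[of x] unfolding B_def by blast
  ultimately have "u \<in> dirichlet_space s \<Omega>" by (simp add: dirichlet_space_def)
  moreover have "0 < (LINT x|lborel. (u x)\<^sup>2)"
  proof (rule ccontr)
    assume "\<not> ?thesis"
    then have "(LINT x|lborel. (u x)\<^sup>2) = 0"
      using Bochner_Integration.integral_nonneg[of lborel "\<lambda>x. (u x)\<^sup>2"] by (simp add: not_less order.antisym)
    then have "AE x in lborel. (u x)\<^sup>2 = 0" by (subst (asm) integral_nonneg_eq_0_iff_AE[OF u2]) auto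
    then have "AE x in lborel. x \<notin> B" by eventually_elim (auto simp: u_def B_def)
    then have "emeasure lborel B = 0" by (subst (asm) AE_iff_measurable[of B]) auto
    then show False using content_ball_pos[OF r(1), of p] by (simp add: B_def measure_def)
  qed
  ultimately show thesis by (rule that)
qed

section \<open>The first eigenvalue is attained\<close>

lemma set_integral_X0_square:
  assumes u: "u \<in> X0 s \<Omega>" and v: "v \<in> dirichlet_space s \<Omega>" and "open \<Omega>"
    and uv: "AE x in lborel. u x = v x"
  shows "(LINT x:\<Omega>|lebesgue. (u x)\<^sup>2) = (LINT x|lborel. (v x)\<^sup>2)"
proof -
  note [measurable] = dirichlet_spaceD(1)[OF v]
  have [measurable]: "u \<in> borel_measurable lebesgue" using u by (simp add: X0_def sobolev_space_def)
  have [measurable]: "\<Omega> \<in> sets lebesgue" using \<open>open \<Omega>\<close> by simp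
  have vm: "(\<lambda>x. (v x)\<^sup>2) \<in> borel_measurable lborel" by measurable
  have "(LINT x:\<Omega>|lebesgue. (u x)\<^sup>2) = (LINT x|lebesgue. (v x)\<^sup>2)"
    unfolding set_lebesgue_integral_def
  proof (rule integral_cong_AE)
    show "AE x in lebesgue. indicator \<Omega> x *\<^sub>R (u x)\<^sup>2 = (v x)\<^sup>2"
      unfolding AE_completion_iff using uv
      by eventually_elim (auto simp: indicator_def dirichlet_spaceD(2)[OF v])
  qed (use measurable_completion[OF vm] in measurable)
  then show ?thesis by (simp add: integral_completion[OF vm])
qed

lemma dirichlet_space_square_pos_iff:
  assumes u: "u \<in> dirichlet_space s \<Omega>"
  shows "0 < (LINT x|lborel. (u x)\<^sup>2) \<longleftrightarrow> \<not> (AE x in lborel. u x = 0)"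
proof -
  have "(LINT x|lborel. (u x)\<^sup>2) = 0 \<longleftrightarrow> (AE x in lborel. (u x)\<^sup>2 = 0)"
    by (rule integral_nonneg_eq_0_iff_AE[OF dirichlet_spaceD(3)[OF u]]) simp
  moreover have "0 \<le> (LINT x|lborel. (u x)\<^sup>2)" by (rule Bochner_Integration.integral_nonneg) simp
  ultimately show ?thesis by (simp add: less_le)
qed

text \<open>
  The growth hypothesis of \<open>integral_superposition_tendsto\<close> for \<open>G x = x\<^sup>2\<close>: the \<open>L\<^sup>2\<close> norm is continuous.
\<close>
lemma square_growth:
  fixes a b :: real
  shows "\<bar>a\<^sup>2 - b\<^sup>2\<bar> \<le> 2 * ((1 + \<bar>b\<bar> + \<bar>a - b\<bar>) * \<bar>a - b\<bar>)"
proof -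
  define t where "t = \<bar>a - b\<bar>"
  have "0 \<le> t" by (simp add: t_def)
  have "\<bar>a + b\<bar> = \<bar>(a - b) + 2 * b\<bar>" by simp
  also have "\<dots> \<le> t + 2 * \<bar>b\<bar>"
    unfolding t_def by (rule order_trans[OF abs_triangle_ineq]) (simp add: abs_mult)
  also have "\<dots> \<le> 2 * (1 + \<bar>b\<bar> + t)" using \<open>0 \<le> t\<close> by simp
  finally have "\<bar>a + b\<bar> * t \<le> 2 * (1 + \<bar>b\<bar> + t) * t" using \<open>0 \<le> t\<close> by (rule mult_right_mono)
  moreover have "\<bar>a\<^sup>2 - b\<^sup>2\<bar> = \<bar>a + b\<bar> * t"
    by (simp add: t_def abs_mult[symmetric] power2_eq_square algebra_simps)
  ultimately show ?thesis by (simp only: t_def[symmetric] mult.assoc)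
qed

text \<open>
  The direct method for the energy on the \<open>L\<^sup>2\<close> unit sphere: the constraint passes to the \<open>L\<^sup>2\<close> limit of a
  minimising sequence, and the energy is lower semicontinuous. The minimum identifies the \<open>LEAST\<close> in the
  definition of the eigenvalue.
\<close>
lemma first_eigenvalue_attained:
  fixes \<Omega> :: "(real ^ 'n) set"
  assumes "0 < s" "s < 1" "open \<Omega>" "bounded \<Omega>" "\<Omega> \<noteq> {}"
  obtains \<phi> where "\<phi> \<in> dirichlet_space s \<Omega>" "0 < (LINT x|lborel. (\<phi> x)\<^sup>2)"
    "energy s \<phi> = first_eigenvalue s \<Omega> * (LINT x|lborel. (\<phi> x)\<^sup>2)" "0 \<le> first_eigenvalue s \<Omega>"
proof -
  have [measurable]: "\<Omega> \<in> sets borel" using \<open>open \<Omega>\<close> by simp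
  define S where "S = {energy s u | u. u \<in> dirichlet_space s \<Omega> \<and> (LINT x|lborel. (u x)\<^sup>2) = 1}"
  define m where "m = Inf S"
  have bdd: "bdd_below S" unfolding S_def by (rule bdd_belowI[of _ 0]) (auto simp: energy_nonneg)
  have scale: "energy s u / (LINT x|lborel. (u x)\<^sup>2) \<in> S"
    if u: "u \<in> dirichlet_space s \<Omega>" "0 < (LINT x|lborel. (u x)\<^sup>2)" for u
  proof -
    define c where "c = 1 / sqrt (LINT x|lborel. (u x)\<^sup>2)"
    have c: "c\<^sup>2 = 1 / (LINT x|lborel. (u x)\<^sup>2)" using u by (simp add: c_def power_divide)
    have "(LINT x|lborel. (c * u x)\<^sup>2) = 1" using c u by (simp add: power_mult_distrib)
    moreover have "energy s (\<lambda>x. c * u x) = energy s u / (LINT x|lborel. (u x)\<^sup>2)"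
      by (simp add: energy_scale c)
    ultimately show ?thesis
      unfolding S_def using dirichlet_space_scale[OF u(1), of c]
      by (intro CollectI exI[of _ "\<lambda>x. c * u x"]) simp
  qed
  have "S \<noteq> {}" using dirichlet_space_nontrivial[OF assms(1,2,3,5)] scale by (metis empty_iff)
  have "\<exists>u. u \<in> dirichlet_space s \<Omega> \<and> (LINT x|lborel. (u x)\<^sup>2) = 1 \<and> energy s u < m + 1 / real (Suc k)" for k
  proof -
    have "Inf S < m + 1 / real (Suc k)" by (simp add: m_def)
    then obtain e where "e \<in> S" "e < m + 1 / real (Suc k)"
      using cInf_less_iff[OF \<open>S \<noteq> {}\<close> bdd] by blast
    then show ?thesis by (auto simp: S_def)
  qed
  then obtain u where u: "\<And>k. u k \<in> dirichlet_space s \<Omega>" "\<And>k. (LINT x|lborel. (u k x)\<^sup>2) = 1"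
    "\<And>k. energy s (u k) < m + 1 / real (Suc k)" by metis
  have "energy s (u k) \<le> m + 1" for k
  proof -
    have "1 / real (Suc k) \<le> 1" by simp
    then show ?thesis using u(3)[of k] by linarith
  qed
  then obtain r :: "nat \<Rightarrow> nat" and v where r: "strict_mono r" and v: "v \<in> dirichlet_space s \<Omega>"
    and L2: "(\<lambda>k. LINT x|lborel. (u (r k) x - v x)\<^sup>2) \<longlonglongrightarrow> 0"
    and lsc: "\<forall>B. (\<forall>\<^sub>F k in sequentially. energy s (u (r k)) \<le> B) \<longrightarrow> energy s v \<le> B"
    by (rule compact_embedding_L2[where u = u, OF \<open>bounded \<Omega>\<close> \<open>open \<Omega>\<close> \<open>0 < s\<close> u(1)])
  note [measurable] = dirichlet_spaceD(1)[OF u(1)] dirichlet_spaceD(1)[OF v]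
  have full: "(LINT x:\<Omega>|lborel. (w x)\<^sup>2) = (LINT x|lborel. (w x)\<^sup>2)" if "w \<in> dirichlet_space s \<Omega>" for w
    unfolding set_lebesgue_integral_def
    by (rule Bochner_Integration.integral_cong) (auto simp: indicator_def dirichlet_spaceD(2)[OF that])
  have "(\<lambda>k. LINT x:\<Omega>|lborel. (u (r k) x)\<^sup>2) \<longlonglongrightarrow> (LINT x:\<Omega>|lborel. (v x)\<^sup>2)"
  proof (rule integral_superposition_tendsto[where G = "\<lambda>x. x\<^sup>2" and K = 2])
    show "emeasure lborel \<Omega> < \<infinity>" using emeasure_bounded_finite[OF \<open>bounded \<Omega>\<close>] by simp
  qed (use square_growth L2 dirichlet_spaceD(3)[OF u(1)] dirichlet_spaceD(3)[OF v] in \<open>auto intro!: continuous_intros\<close>)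
  then have "(LINT x|lborel. (v x)\<^sup>2) = 1"
    by (simp add: full u v LIMSEQ_const_iff)
  then have "energy s v \<in> S" using v by (auto simp: S_def)
  then have "m \<le> energy s v" unfolding m_def using bdd by (rule cInf_lower)
  moreover have "energy s v \<le> m"
  proof (rule field_le_epsilon)
    fix e :: real assume "0 < e"
    have "(\<lambda>k. m + 1 / real (Suc k)) \<longlonglongrightarrow> m + 0"
      by (intro tendsto_intros LIMSEQ_Suc lim_1_over_n)
    then have "((\<lambda>k. m + 1 / real (Suc k)) \<circ> r) \<longlonglongrightarrow> m" using LIMSEQ_subseq_LIMSEQ r by fastforce
    then have "\<forall>\<^sub>F k in sequentially. ((\<lambda>k. m + 1 / real (Suc k)) \<circ> r) k < m + e"
      by (rule order_tendstoD(2)) (simp add: \<open>0 < e\<close>)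
    then have "\<forall>\<^sub>F k in sequentially. energy s (u (r k)) \<le> m + e"
    proof eventually_elim
      fix k assume "((\<lambda>k. m + 1 / real (Suc k)) \<circ> r) k < m + e"
      then show "energy s (u (r k)) \<le> m + e" using u(3)[of "r k"] by (simp only: o_def)
    qed
    then show "energy s v \<le> m + e" by (rule lsc[rule_format])
  qed
  ultimately have em: "energy s v = m" by simp
  have "first_eigenvalue s \<Omega> = m"
    unfolding first_eigenvalue_def
  proof (rule Least_equality)
    have "v \<in> X0 s \<Omega>" using v dirichlet_space_subset_X0 by blast
    moreover have "(LINT x:\<Omega>|lebesgue. (v x)\<^sup>2) = 1"
      using set_integral_X0_square[OF \<open>v \<in> X0 s \<Omega>\<close> v \<open>open \<Omega>\<close>] \<open>(LINT x|lborel. (v x)\<^sup>2) = 1\<close> by simp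
    moreover have "\<not> (AE x in lebesgue. v x = 0)"
      using dirichlet_space_square_pos_iff[OF v] \<open>(LINT x|lborel. (v x)\<^sup>2) = 1\<close> by (simp add: AE_completion_iff)
    ultimately show "m \<in> {energy s u / (LINT x:\<Omega>|lebesgue. (u x)\<^sup>2) |u. u \<in> X0 s \<Omega> \<and> \<not> (AE x in lebesgue. u x = 0)}"
      using em by (intro CollectI exI[of _ v]) simp
  next
    fix l assume "l \<in> {energy s u / (LINT x:\<Omega>|lebesgue. (u x)\<^sup>2) |u. u \<in> X0 s \<Omega> \<and> \<not> (AE x in lebesgue. u x = 0)}"
    then obtain w where w: "w \<in> X0 s \<Omega>" "\<not> (AE x in lebesgue. w x = 0)"
      and l: "l = energy s w / (LINT x:\<Omega>|lebesgue. (w x)\<^sup>2)" by blast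
    obtain z where z: "z \<in> dirichlet_space s \<Omega>" "AE x in lborel. w x = z x"
      by (rule X0_borel_representative[OF w(1) \<open>open \<Omega>\<close>])
    have "\<not> (AE x in lborel. z x = 0)"
    proof
      assume "AE x in lborel. z x = 0"
      with z(2) have "AE x in lborel. w x = 0" by eventually_elim simp
      then show False using w(2) by (simp add: AE_completion_iff)
    qed
    then have "0 < (LINT x|lborel. (z x)\<^sup>2)" by (simp add: dirichlet_space_square_pos_iff[OF z(1)])
    then have "energy s z / (LINT x|lborel. (z x)\<^sup>2) \<in> S" by (rule scale[OF z(1)])
    moreover have "energy s w = energy s z"
      by (rule gagliardo_form_cong_AE(1)) (use z dirichlet_spaceD(1)[OF z(1)] in auto)
    ultimately have "l \<in> S" using set_integral_X0_square[OF w(1) z(1) \<open>open \<Omega>\<close> z(2)] l by simp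
    then show "m \<le> l" unfolding m_def using bdd by (rule cInf_lower)
  qed
  then show thesis using that[of v] v em \<open>(LINT x|lborel. (v x)\<^sup>2) = 1\<close> energy_nonneg[of s v] by simp
qed

section \<open>The nonlinearity\<close>

text \<open>
  The primitive of \<open>\<lambda>t. f (max 0 t)\<close> that vanishes at \<open>0\<close>; the second integral is over an empty or
  one-point interval when \<open>x \<ge> 0\<close>, and the first one when \<open>x \<le> 0\<close>. Extending \<open>f\<close> by the constant \<open>f 0\<close>
  keeps the primitive differentiable at \<open>0\<close> even when \<open>f 0 > 0\<close>.
\<close>
definition extended_primitive :: "(real \<Rightarrow> real) \<Rightarrow> real \<Rightarrow> real" where
  "extended_primitive f x = primitive f x - integral {x..0} (\<lambda>t. f 0)"

lemma extended_primitive_nonneg: "0 \<le> x \<Longrightarrow> extended_primitive f x = primitive f x"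
  by (cases "x = 0") (auto simp: extended_primitive_def primitive_def)

lemma extended_primitive_nonpos: "x \<le> 0 \<Longrightarrow> extended_primitive f x = f 0 * x"
  by (cases "x = 0") (auto simp: extended_primitive_def primitive_def)

lemma DERIV_extended_primitive:
  assumes "continuous_on {0..} f"
  shows "(extended_primitive f has_field_derivative f (max 0 x)) (at x)"
proof -
  define g where "g t = f (max 0 t)" for t
  have g: "continuous_on A g" for A
    unfolding g_def by (rule continuous_on_compose2[OF assms]) (auto intro!: continuous_intros)
  \<comment> \<open>A base point \<open>- M\<close> to the left of \<open>x\<close> and \<open>0\<close> makes one integral formula valid on both sides of \<open>0\<close>.\<close>
  define M where "M = \<bar>x\<bar> + 1"
  have M: "- M < x" "x < M" "0 < M" by (auto simp: M_def)
  have int: "g integrable_on {a..b}" for a b by (rule integrable_continuous_real[OF g])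
  have eq: "extended_primitive f y = integral {- M..y} g - integral {- M..0} g" if "- M < y" for y
  proof (cases "0 \<le> y")
    case True
    have "integral {- M..0} g + integral {0..y} g = integral {- M..y} g"
      using True M by (intro Henstock_Kurzweil_Integration.integral_combine int) auto
    moreover have "integral {0..y} g = integral {0..y} f"
      by (rule integral_cong) (simp add: g_def)
    ultimately show ?thesis using True by (simp add: extended_primitive_nonneg primitive_def)
  next
    case False
    have "integral {- M..y} g + integral {y..0} g = integral {- M..0} g"
      using False that by (intro Henstock_Kurzweil_Integration.integral_combine int) auto
    moreover have "integral {y..0} g = integral {y..0} (\<lambda>t. f 0)"
      by (rule integral_cong) (auto simp: g_def max_def)
    ultimately show ?thesis using False by (simp add: extended_primitive_nonpos algebra_simps)
  qed
  have "((\<lambda>y. integral {- M..y} g) has_real_derivative g x) (at x within {- M..M})"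
    using M by (intro integral_has_real_derivative g) auto
  then have "((\<lambda>y. integral {- M..y} g) has_real_derivative g x) (at x)"
    using M by (simp add: at_within_Icc_at)
  then have "((\<lambda>y. integral {- M..y} g - integral {- M..0} g) has_real_derivative g x) (at x)"
    by (auto intro!: derivative_eq_intros)
  then show ?thesis unfolding g_def[symmetric]
  proof (rule has_field_derivative_transform_within_open[of _ _ _ "{- M<..<M}"])
  qed (use M eq in auto)
qed

text \<open>
  For \<open>\<xi> / 2 \<le> t \<le> \<xi>\<close> the monotonicity gives \<open>f t \<ge> f \<xi> * (t / \<xi>) powr (q - 1) \<ge> f \<xi> * 2 powr (1 - q)\<close>;
  integrating over \<open>[\<xi> / 2, \<xi>]\<close> bounds the primitive from below.
\<close>
lemma decreasing_quotient_bound: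
  assumes f: "continuous_on {0..} f" "f ` {0..} \<subseteq> {0..}" and "1 \<le> q"
    and dec: "strict_antimono_on {0<..} (\<lambda>t. f t / t powr (q - 1))" and "0 < \<xi>"
  shows "f \<xi> * \<xi> \<le> 2 powr q * primitive f \<xi>"
proof -
  have f0: "0 \<le> f t" if "0 \<le> t" for t using f(2) that by auto
  have int: "f integrable_on {a..b}" if "0 \<le> a" for a b
    using that by (intro integrable_continuous_real continuous_on_subset[OF f(1)]) auto
  have low: "f \<xi> * 2 powr (1 - q) \<le> f t" if t: "\<xi> / 2 \<le> t" "t \<le> \<xi>" for t
  proof -
    have "0 < t" using t \<open>0 < \<xi>\<close> by linarith
    have le: "f \<xi> / \<xi> powr (q - 1) \<le> f t / t powr (q - 1)"
    proof (cases "t = \<xi>")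
      case False
      then show ?thesis using monotone_onD[OF dec, of t \<xi>] t \<open>0 < t\<close> by simp
    qed simp
    have "2 powr (1 - q) = (1 / 2) powr (q - 1)" by (simp add: powr_divide powr_minus_divide[symmetric])
    also have "\<dots> \<le> (t / \<xi>) powr (q - 1)"
      using t \<open>0 < \<xi>\<close> \<open>1 \<le> q\<close> by (intro powr_mono2) (auto simp: field_simps)
    also have "\<dots> = t powr (q - 1) / \<xi> powr (q - 1)"
      using \<open>0 < t\<close> \<open>0 < \<xi>\<close> by (simp add: powr_divide)
    finally have "f \<xi> * 2 powr (1 - q) \<le> f \<xi> * (t powr (q - 1) / \<xi> powr (q - 1))"
      using f0[of \<xi>] \<open>0 < \<xi>\<close> by (intro mult_left_mono) auto
    also have "\<dots> = f \<xi> / \<xi> powr (q - 1) * t powr (q - 1)" by simp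
    also have "\<dots> \<le> f t / t powr (q - 1) * t powr (q - 1)"
      using le by (intro mult_right_mono) auto
    also have "\<dots> = f t" using \<open>0 < t\<close> by simp
    finally show ?thesis .
  qed
  have "f \<xi> * 2 powr (1 - q) * (\<xi> / 2) = integral {\<xi> / 2..\<xi>} (\<lambda>t. f \<xi> * 2 powr (1 - q))"
    using \<open>0 < \<xi>\<close> by simp
  also have "\<dots> \<le> integral {\<xi> / 2..\<xi>} f"
    using \<open>0 < \<xi>\<close> low by (intro integral_le int) auto
  also have "\<dots> \<le> integral {0..\<xi>} f"
    using \<open>0 < \<xi>\<close> f0 by (intro integral_subset_le int) auto
  finally have "2 powr q * (f \<xi> * 2 powr (1 - q) * (\<xi> / 2)) \<le> 2 powr q * primitive f \<xi>"
    unfolding primitive_def by (intro mult_left_mono) auto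
  moreover have "2 powr q * (f \<xi> * 2 powr (1 - q) * (\<xi> / 2)) = (2 powr q * 2 powr (1 - q)) / 2 * (f \<xi> * \<xi>)"
    by simp
  moreover have "(2::real) powr q * 2 powr (1 - q) = 2" by (simp add: powr_add[symmetric])
  ultimately show ?thesis by (simp only:)
qed

lemma primitive_nonneg:
  assumes "continuous_on {0..} f" "f ` {0..} \<subseteq> {0..}"
  shows "0 \<le> primitive f a"
  unfolding primitive_def using assms
  by (intro Henstock_Kurzweil_Integration.integral_nonneg integrable_continuous_real)
    (auto intro: continuous_on_subset simp: image_subset_iff)

lemma primitive_mono:
  assumes f: "continuous_on {0..} f" "f ` {0..} \<subseteq> {0..}" and "a \<le> b"
  shows "primitive f a \<le> primitive f b"
proof -
  have "f integrable_on {0..c}" for c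
    by (intro integrable_continuous_real continuous_on_subset[OF f(1)]) auto
  then show ?thesis
    unfolding primitive_def using f(2) \<open>a \<le> b\<close>
    by (intro integral_subset_le) (auto simp: image_subset_iff)
qed

lemma primitive_subquadratic:
  assumes f: "continuous_on {0..} f" "f ` {0..} \<subseteq> {0..}"
    and lim: "((\<lambda>\<xi>. primitive f \<xi> / \<xi>\<^sup>2) \<longlongrightarrow> 0) at_top" and "0 < \<epsilon>"
  obtains C where "0 \<le> C" "\<And>t. primitive f t \<le> \<epsilon> * t\<^sup>2 + C"
proof -
  have "\<forall>\<^sub>F \<xi> in at_top. primitive f \<xi> / \<xi>\<^sup>2 < \<epsilon>" using lim \<open>0 < \<epsilon>\<close> by (rule order_tendstoD)
  then obtain X where X: "\<And>\<xi>. X \<le> \<xi> \<Longrightarrow> primitive f \<xi> / \<xi>\<^sup>2 < \<epsilon>"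
    by (auto simp: eventually_at_top_linorder)
  define Y where "Y = max X 1"
  show thesis
  proof
    show "0 \<le> primitive f Y" by (rule primitive_nonneg[OF f])
    show "primitive f t \<le> \<epsilon> * t\<^sup>2 + primitive f Y" for t
    proof (cases "t \<le> Y")
      case True
      then show ?thesis using primitive_mono[OF f True] \<open>0 < \<epsilon>\<close> by (simp add: add_increasing)
    next
      case False
      then have "primitive f t / t\<^sup>2 < \<epsilon>" "0 < t" by (auto simp: Y_def intro!: X)
      then have "primitive f t < \<epsilon> * t\<^sup>2" by (simp add: field_simps)
      then show ?thesis using primitive_nonneg[OF f, of Y] by simp
    qed
  qed
qed

text \<open>
  Below \<open>1\<close> the function is bounded by compactness; above \<open>1\<close> the bound of \<open>decreasing_quotient_bound\<close> is
  combined with the at most quadratic growth of the primitive.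
\<close>
lemma linear_growth:
  assumes f: "continuous_on {0..} f" "f ` {0..} \<subseteq> {0..}" and "1 \<le> q"
    and dec: "strict_antimono_on {0<..} (\<lambda>t. f t / t powr (q - 1))"
    and lim: "((\<lambda>\<xi>. primitive f \<xi> / \<xi>\<^sup>2) \<longlongrightarrow> 0) at_top"
  obtains K where "0 \<le> K" "\<forall>t\<ge>0. f t \<le> K * (1 + t)"
proof -
  obtain C where C: "0 \<le> C" "\<And>t. primitive f t \<le> 1 * t\<^sup>2 + C"
    using primitive_subquadratic[OF f lim, of 1] by auto
  obtain B where B: "\<And>t. 0 \<le> t \<Longrightarrow> t \<le> 1 \<Longrightarrow> \<bar>f t\<bar> \<le> B"
  proof -
    have "compact (f ` {0..1})" by (intro compact_continuous_image continuous_on_subset[OF f(1)]) auto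
    then have "bounded (f ` {0..1})" by (rule compact_imp_bounded)
    then obtain a where "\<forall>x\<in>{0..1}. \<bar>f x\<bar> \<le> a" by (auto simp: bounded_iff)
    then show thesis using that[of a] by simp
  qed
  have "0 \<le> B" using B[of 0] by simp
  define K where "K = B + 2 powr q * (1 + C)"
  have "0 \<le> 2 powr q * (1 + C)" using C by simp
  show thesis
  proof
    show "0 \<le> K" using \<open>0 \<le> B\<close> \<open>0 \<le> 2 powr q * (1 + C)\<close> by (simp add: K_def)
    show "\<forall>t\<ge>0. f t \<le> K * (1 + t)"
    proof (intro allI impI)
      fix t :: real assume "0 \<le> t"
      show "f t \<le> K * (1 + t)"
      proof (cases "t \<le> 1")
        case True
        then have "f t \<le> B" using B[OF \<open>0 \<le> t\<close>] by simp
        also have "\<dots> \<le> K * 1" using \<open>0 \<le> 2 powr q * (1 + C)\<close> by (simp add: K_def)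
        also have "\<dots> \<le> K * (1 + t)" using \<open>0 \<le> K\<close> \<open>0 \<le> t\<close> by (intro mult_left_mono) auto
        finally show ?thesis .
      next
        case False
        then have "1 < t" by simp
        have "f t * t \<le> 2 powr q * primitive f t"
          using False by (intro decreasing_quotient_bound[OF f \<open>1 \<le> q\<close> dec]) auto
        also have "\<dots> \<le> 2 powr q * (t\<^sup>2 + C)" using C(2)[of t] by (intro mult_left_mono) auto
        also have "\<dots> \<le> 2 powr q * ((1 + C) * t\<^sup>2)"
        proof (intro mult_left_mono)
          have "1 \<le> t\<^sup>2" using \<open>1 < t\<close> by simp
          then show "t\<^sup>2 + C \<le> (1 + C) * t\<^sup>2" using C(1) mult_left_mono[of 1 "t\<^sup>2" C] by (simp add: algebra_simps)
        qed simp
        finally have "f t * t \<le> (2 powr q * (1 + C) * t) * t" by (simp add: power2_eq_square mult_ac)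
        then have "f t \<le> 2 powr q * (1 + C) * t" using \<open>1 < t\<close> by simp
        also have "\<dots> \<le> K * (1 + t)" using \<open>0 \<le> B\<close> \<open>0 \<le> 2 powr q * (1 + C)\<close> \<open>0 \<le> t\<close>
          by (intro mult_mono) (auto simp: K_def)
        finally show ?thesis .
      qed
    qed
  qed
qed

text \<open>
  The mean value inequality on the segment between \<open>a\<close> and \<open>b\<close>, where the derivative is at most
  \<open>K * (1 + \<bar>b\<bar> + \<bar>a - b\<bar>)\<close>.
\<close>
lemma extended_primitive_growth:
  assumes f: "continuous_on {0..} f" "f ` {0..} \<subseteq> {0..}" and "0 \<le> K"
    and K: "\<forall>t\<ge>0. f t \<le> K * (1 + t)"
  shows "\<bar>extended_primitive f a - extended_primitive f b\<bar> \<le> K * ((1 + \<bar>b\<bar> + \<bar>a - b\<bar>) * \<bar>a - b\<bar>)"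
proof -
  have "norm (extended_primitive f a - extended_primitive f b) \<le> (K * (1 + \<bar>b\<bar> + \<bar>a - b\<bar>)) * norm (a - b)"
  proof (rule field_differentiable_bound)
    show "convex (closed_segment b a)" by simp
    fix t assume t: "t \<in> closed_segment b a"
    show "(extended_primitive f has_field_derivative f (max 0 t)) (at t within closed_segment b a)"
      by (rule has_field_derivative_at_within) (rule DERIV_extended_primitive[OF f(1)])
    have "max 0 t \<le> \<bar>b\<bar> + \<bar>a - b\<bar>" using t by (auto simp: closed_segment_eq_real_ivl split: if_splits)
    then have "K * (1 + max 0 t) \<le> K * (1 + \<bar>b\<bar> + \<bar>a - b\<bar>)" using \<open>0 \<le> K\<close> by (intro mult_left_mono) auto
    moreover have "0 \<le> f (max 0 t)" using f(2) by (auto simp: image_subset_iff)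
    ultimately show "norm (f (max 0 t)) \<le> K * (1 + \<bar>b\<bar> + \<bar>a - b\<bar>)" using K[rule_format, of "max 0 t"] by simp
  qed auto
  then show ?thesis by (simp add: mult.assoc)
qed

text \<open>
  Any \<open>c\<close> strictly between \<open>l / (2 \<alpha>)\<close> and the lower limit works; it exists also when the lower limit is
  infinite. The positivity of \<open>\<alpha>\<close> comes from \<open>l \<ge> 0\<close>.
\<close>
lemma quadratic_lower_bound_near_0:
  assumes "0 < liminf_quotient f" and "0 \<le> l" and "ereal \<alpha> > ereal l / (2 * liminf_quotient f)"
  obtains c \<delta> where "0 < \<alpha>" "l < 2 * \<alpha> * c" "0 < \<delta>"
    "\<And>t. 0 < t \<Longrightarrow> t < \<delta> \<Longrightarrow> c * t\<^sup>2 \<le> primitive f t"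
proof -
  have "0 \<le> ereal l / (2 * liminf_quotient f)"
    using assms(1,2) by (cases "liminf_quotient f") auto
  then have "0 < ereal \<alpha>" using assms(3) by (rule order_le_less_trans)
  then have \<alpha>: "0 < \<alpha>" by simp
  have "ereal (l / (2 * \<alpha>)) < liminf_quotient f"
  proof (cases "liminf_quotient f")
    case (real L)
    then have "0 < L" "l / (2 * L) < \<alpha>" using assms(1,3) by auto
    then show ?thesis using \<alpha> real by (simp add: field_simps)
  qed (use assms(1) in auto)
  then obtain c where c: "ereal (l / (2 * \<alpha>)) < ereal c" "ereal c < liminf_quotient f"
    using ereal_dense2 by blast
  then have "\<forall>\<^sub>F \<xi> in at_right 0. ereal c < ereal (primitive f \<xi> / \<xi>\<^sup>2)"
    unfolding liminf_quotient_def by (intro less_LiminfD)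
  then obtain \<delta> where "0 < \<delta>" "\<And>t. 0 < t \<Longrightarrow> t < \<delta> \<Longrightarrow> c < primitive f t / t\<^sup>2"
    by (auto simp: eventually_at_right_field)
  then have "c * t\<^sup>2 \<le> primitive f t" if "0 < t" "t < \<delta>" for t
    using that by (force simp: pos_less_divide_eq)
  moreover have "l < 2 * \<alpha> * c" using c(1) \<alpha> by (simp add: field_simps)
  ultimately show thesis using that \<alpha> \<open>0 < \<delta>\<close> by blast
qed

section \<open>Minimisation of the Euler functional\<close>

definition euler_functional :: "real \<Rightarrow> (real ^ 'n) set \<Rightarrow> real \<Rightarrow> (real \<Rightarrow> real) \<Rightarrow> (real ^ 'n \<Rightarrow> real) \<Rightarrow> real" where
  "euler_functional s \<Omega> \<alpha> f u = energy s u / 2 - \<alpha> * (LINT x:\<Omega>|lborel. extended_primitive f (u x))"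

lemma continuous_extended_primitive:
  "continuous_on {0..} f \<Longrightarrow> continuous_on UNIV (extended_primitive f)"
  using DERIV_extended_primitive by (meson DERIV_continuous_on has_field_derivative_at_within)

text \<open>
  For negative \<open>x\<close> the left side is \<open>f 0 * x \<le> 0\<close>. This lets a minimiser be replaced by its absolute value.
\<close>
lemma extended_primitive_abs_le:
  assumes f: "continuous_on {0..} f" "f ` {0..} \<subseteq> {0..}"
  shows "extended_primitive f x \<le> extended_primitive f \<bar>x\<bar>"
proof (cases "0 \<le> x")
  case False
  have "0 \<le> f 0" using f(2) by auto
  then have "f 0 * x \<le> 0" using False by (simp add: mult_nonneg_nonpos)
  also have "0 \<le> primitive f \<bar>x\<bar>" by (rule primitive_nonneg[OF f])
  finally show ?thesis using False by (simp add: extended_primitive_nonneg extended_primitive_nonpos)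
qed simp

lemma set_integrable_extended_primitive:
  fixes u :: "real ^ 'n \<Rightarrow> real"
  assumes f: "continuous_on {0..} f" "f ` {0..} \<subseteq> {0..}" and "0 \<le> K"
    and K: "\<forall>t\<ge>0. f t \<le> K * (1 + t)"
    and "open \<Omega>" "bounded \<Omega>" and u: "u \<in> dirichlet_space s \<Omega>"
  shows "set_integrable lborel \<Omega> (\<lambda>x. extended_primitive f (u x))"
proof (rule set_integrable_superposition[where G = "extended_primitive f" and K = K])
  show "emeasure lborel \<Omega> < \<infinity>" using emeasure_bounded_finite[OF \<open>bounded \<Omega>\<close>] by simp
qed (use \<open>open \<Omega>\<close> dirichlet_spaceD[OF u] continuous_extended_primitive[OF f(1)]
      extended_primitive_growth[OF f \<open>0 \<le> K\<close> K] \<open>0 \<le> K\<close> in auto)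

text \<open>
  The primitive is at most \<open>\<epsilon> t\<^sup>2 + B\<close> for every \<open>\<epsilon> > 0\<close>. With the Poincare constant \<open>C\<close> and
  \<open>\<epsilon> = 1 / (4 \<alpha> C)\<close> the potential term absorbs only half of the quadratic term \<open>energy s u / 2\<close>.
\<close>
lemma euler_functional_coercive:
  fixes \<Omega> :: "(real ^ 'n) set"
  assumes "0 < s" and "open \<Omega>" "bounded \<Omega>" and "0 < \<alpha>"
    and f: "continuous_on {0..} f" "f ` {0..} \<subseteq> {0..}" and "0 \<le> K"
    and K: "\<forall>t\<ge>0. f t \<le> K * (1 + t)"
    and lim: "((\<lambda>\<xi>. primitive f \<xi> / \<xi>\<^sup>2) \<longlongrightarrow> 0) at_top"
  obtains b where "\<And>u. u \<in> dirichlet_space s \<Omega> \<Longrightarrow> energy s u / 4 - b \<le> euler_functional s \<Omega> \<alpha> f u"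
proof -
  obtain C where C: "0 < C" "\<And>u. u \<in> dirichlet_space s \<Omega> \<Longrightarrow> (LINT x|lborel. (u x)\<^sup>2) \<le> C * energy s u"
    using poincare_inequality[OF \<open>bounded \<Omega>\<close> \<open>0 < s\<close>] by metis
  have "0 < 1 / (4 * \<alpha> * C)" using \<open>0 < \<alpha>\<close> C by simp
  then obtain B where B: "0 \<le> B" "\<And>t. primitive f t \<le> 1 / (4 * \<alpha> * C) * t\<^sup>2 + B"
    using primitive_subquadratic[OF f lim] by metis
  have fin: "emeasure lborel \<Omega> < \<infinity>" using emeasure_bounded_finite[OF \<open>bounded \<Omega>\<close>] by simp
  have [measurable]: "\<Omega> \<in> sets borel" using \<open>open \<Omega>\<close> by simp
  have bound: "extended_primitive f t \<le> 1 / (4 * \<alpha> * C) * t\<^sup>2 + B" for t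
    using extended_primitive_abs_le[OF f, of t] B(2)[of "\<bar>t\<bar>"] by (simp add: extended_primitive_nonneg)
  show thesis
  proof
    fix u assume u: "u \<in> dirichlet_space s \<Omega>"
    note si = set_integrable_extended_primitive[OF f \<open>0 \<le> K\<close> K \<open>open \<Omega>\<close> \<open>bounded \<Omega>\<close> u]
    have i1: "integrable lborel (\<lambda>x. indicator \<Omega> x :: real)" using fin by (intro integrable_real_indicator) auto
    have "(LINT x:\<Omega>|lborel. extended_primitive f (u x)) \<le> (LINT x|lborel. 1 / (4 * \<alpha> * C) * (u x)\<^sup>2 + B * indicator \<Omega> x)"
      unfolding set_lebesgue_integral_def
    proof (rule integral_mono)
      show "integrable lborel (\<lambda>x. 1 / (4 * \<alpha> * C) * (u x)\<^sup>2 + B * indicator \<Omega> x)"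
        using dirichlet_spaceD(3)[OF u] i1 by (intro Bochner_Integration.integrable_add integrable_mult_right)
      show "indicator \<Omega> x *\<^sub>R extended_primitive f (u x) \<le> 1 / (4 * \<alpha> * C) * (u x)\<^sup>2 + B * indicator \<Omega> x" for x
        using bound[of "u x"] \<open>0 < \<alpha>\<close> C(1) B(1) by (auto simp: indicator_def)
    qed (use si in \<open>simp add: set_integrable_def\<close>)
    also have "\<dots> = 1 / (4 * \<alpha> * C) * (LINT x|lborel. (u x)\<^sup>2) + B * measure lborel \<Omega>"
      using dirichlet_spaceD(3)[OF u] i1 fin by (subst Bochner_Integration.integral_add) auto
    also have "\<dots> \<le> 1 / (4 * \<alpha> * C) * (C * energy s u) + B * measure lborel \<Omega>"
      using \<open>0 < 1 / (4 * \<alpha> * C)\<close> C(2)[OF u] by (intro add_right_mono mult_left_mono) auto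
    also have "\<dots> = energy s u / (4 * \<alpha>) + B * measure lborel \<Omega>" using C(1) by simp
    finally have "\<alpha> * (LINT x:\<Omega>|lborel. extended_primitive f (u x)) \<le> \<alpha> * (energy s u / (4 * \<alpha>) + B * measure lborel \<Omega>)"
      using \<open>0 < \<alpha>\<close> by (intro mult_left_mono) auto
    also have "\<dots> = energy s u / 4 + \<alpha> * B * measure lborel \<Omega>" using \<open>0 < \<alpha>\<close> by (simp add: field_simps)
    finally show "energy s u / 4 - \<alpha> * B * measure lborel \<Omega> \<le> euler_functional s \<Omega> \<alpha> f u"
      by (simp add: euler_functional_def)
  qed
qed

text \<open>
  A minimising sequence has bounded energy by coercivity. Along the subsequence of
  \<open>compact_embedding_L2\<close> the potential term converges, so the bound on the functional becomes an eventual
  bound on the energies, to which lower semicontinuity applies.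
\<close>
lemma euler_functional_minimizer_exists:
  fixes \<Omega> :: "(real ^ 'n) set"
  assumes "0 < s" and "open \<Omega>" "bounded \<Omega>" and "0 < \<alpha>"
    and f: "continuous_on {0..} f" "f ` {0..} \<subseteq> {0..}" and "0 \<le> K"
    and K: "\<forall>t\<ge>0. f t \<le> K * (1 + t)"
    and lim: "((\<lambda>\<xi>. primitive f \<xi> / \<xi>\<^sup>2) \<longlongrightarrow> 0) at_top"
  obtains u where "u \<in> dirichlet_space s \<Omega>" "\<And>x. 0 \<le> u x"
    "\<And>w. w \<in> dirichlet_space s \<Omega> \<Longrightarrow> euler_functional s \<Omega> \<alpha> f u \<le> euler_functional s \<Omega> \<alpha> f w"
proof -
  obtain b where b: "\<And>u. u \<in> dirichlet_space s \<Omega> \<Longrightarrow> energy s u / 4 - b \<le> euler_functional s \<Omega> \<alpha> f u"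
    using euler_functional_coercive[OF assms] by blast
  have [measurable]: "\<Omega> \<in> sets borel" using \<open>open \<Omega>\<close> by simp
  define S where "S = euler_functional s \<Omega> \<alpha> f ` dirichlet_space s \<Omega>"
  define m where "m = Inf S"
  have lb: "- b \<le> euler_functional s \<Omega> \<alpha> f u" if "u \<in> dirichlet_space s \<Omega>" for u
    using b[OF that] energy_nonneg[of s u] by linarith
  then have bdd: "bdd_below S" unfolding S_def by (intro bdd_belowI[of _ "- b"]) auto
  have "S \<noteq> {}" using zero_in_dirichlet_space(1) by (auto simp: S_def)
  have "\<exists>u. u \<in> dirichlet_space s \<Omega> \<and> euler_functional s \<Omega> \<alpha> f u < m + 1 / real (Suc k)" for k
  proof -
    have "Inf S < m + 1 / real (Suc k)" by (simp add: m_def)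
    then obtain e where "e \<in> S" "e < m + 1 / real (Suc k)"
      using cInf_less_iff[OF \<open>S \<noteq> {}\<close> bdd] by blast
    then show ?thesis by (auto simp: S_def)
  qed
  then obtain u where u: "\<And>k. u k \<in> dirichlet_space s \<Omega>" "\<And>k. euler_functional s \<Omega> \<alpha> f (u k) < m + 1 / real (Suc k)"
    by metis
  have "energy s (u k) \<le> 4 * (m + 1 + b)" for k
  proof -
    have "energy s (u k) / 4 - b \<le> m + 1 / real (Suc k)"
      by (rule order_trans[OF b[OF u(1)] less_imp_le[OF u(2)]])
    also have "\<dots> \<le> m + 1" by simp
    finally show ?thesis by simp
  qed
  then obtain r :: "nat \<Rightarrow> nat" and v where r: "strict_mono r" and v: "v \<in> dirichlet_space s \<Omega>"
    and L2: "(\<lambda>k. LINT x|lborel. (u (r k) x - v x)\<^sup>2) \<longlonglongrightarrow> 0"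
    and lsc: "\<forall>B. (\<forall>\<^sub>F k in sequentially. energy s (u (r k)) \<le> B) \<longrightarrow> energy s v \<le> B"
    by (rule compact_embedding_L2[where u = u, OF \<open>bounded \<Omega>\<close> \<open>open \<Omega>\<close> \<open>0 < s\<close> u(1)])
  define P where "P w = (LINT x:\<Omega>|lborel. extended_primitive f (w x))" for w :: "real ^ 'n \<Rightarrow> real"
  have P_lim: "(\<lambda>k. P (u (r k))) \<longlonglongrightarrow> P v"
    unfolding P_def
  proof (rule integral_superposition_tendsto[where G = "extended_primitive f" and K = K])
    show "emeasure lborel \<Omega> < \<infinity>" using emeasure_bounded_finite[OF \<open>bounded \<Omega>\<close>] by simp
  qed (use dirichlet_spaceD[OF u(1)] dirichlet_spaceD[OF v] continuous_extended_primitive[OF f(1)] L2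
      extended_primitive_growth[OF f \<open>0 \<le> K\<close> K] \<open>0 \<le> K\<close> in auto)
  have act: "euler_functional s \<Omega> \<alpha> f w = energy s w / 2 - \<alpha> * P w" for w
    by (simp add: euler_functional_def P_def)
  have "euler_functional s \<Omega> \<alpha> f v \<le> m"
  proof (rule field_le_epsilon)
    fix e :: real assume "0 < e"
    have s1: "(\<lambda>k. 1 / real (Suc k)) \<longlonglongrightarrow> 0" by (intro LIMSEQ_Suc lim_1_over_n)
    have "((\<lambda>k. 1 / real (Suc k)) \<circ> r) \<longlonglongrightarrow> 0" by (rule LIMSEQ_subseq_LIMSEQ[OF s1 r])
    then have "(\<lambda>k. 2 * (m + ((\<lambda>k. 1 / real (Suc k)) \<circ> r) k + \<alpha> * P (u (r k)))) \<longlonglongrightarrow> 2 * (m + 0 + \<alpha> * P v)"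
      by (intro tendsto_intros P_lim)
    then have "\<forall>\<^sub>F k in sequentially. 2 * (m + ((\<lambda>k. 1 / real (Suc k)) \<circ> r) k + \<alpha> * P (u (r k))) < 2 * (m + \<alpha> * P v) + 2 * e"
      by (rule order_tendstoD(2)) (simp add: \<open>0 < e\<close>)
    then have "\<forall>\<^sub>F k in sequentially. energy s (u (r k)) \<le> 2 * (m + \<alpha> * P v) + 2 * e"
    proof eventually_elim
      fix k assume "2 * (m + ((\<lambda>k. 1 / real (Suc k)) \<circ> r) k + \<alpha> * P (u (r k))) < 2 * (m + \<alpha> * P v) + 2 * e"
      moreover have "energy s (u (r k)) / 2 - \<alpha> * P (u (r k)) < m + ((\<lambda>k. 1 / real (Suc k)) \<circ> r) k"
        using u(2)[of "r k"] by (simp add: act)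
      ultimately show "energy s (u (r k)) \<le> 2 * (m + \<alpha> * P v) + 2 * e" by argo
    qed
    then have "energy s v \<le> 2 * (m + \<alpha> * P v) + 2 * e" by (rule lsc[rule_format])
    then show "euler_functional s \<Omega> \<alpha> f v \<le> m + e" by (simp add: act)
  qed
  note va = dirichlet_space_abs[OF v]
  have "P v \<le> P (\<lambda>x. \<bar>v x\<bar>)"
    unfolding P_def using set_integrable_extended_primitive[OF f \<open>0 \<le> K\<close> K \<open>open \<Omega>\<close> \<open>bounded \<Omega>\<close>] v va(1)
    by (intro set_integral_mono extended_primitive_abs_le[OF f]) auto
  then have "\<alpha> * P v \<le> \<alpha> * P (\<lambda>x. \<bar>v x\<bar>)" using \<open>0 < \<alpha>\<close> by simp
  then have "euler_functional s \<Omega> \<alpha> f (\<lambda>x. \<bar>v x\<bar>) \<le> m"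
    using va(2) \<open>euler_functional s \<Omega> \<alpha> f v \<le> m\<close> unfolding act by linarith
  moreover have "m \<le> euler_functional s \<Omega> \<alpha> f w" if "w \<in> dirichlet_space s \<Omega>" for w
    unfolding m_def using that bdd by (intro cInf_lower) (auto simp: S_def)
  ultimately show thesis using va(1) by (intro that[of "\<lambda>x. \<bar>v x\<bar>"]) (auto intro: order_trans)
qed

text \<open>
  Dominated convergence: by the growth bound the difference quotients with steps in \<open>(0, 1]\<close> are dominated by
  \<open>K * (1 + \<bar>u\<bar> + \<bar>\<phi>\<bar>) * \<bar>\<phi>\<bar>\<close>, which is integrable over the bounded set \<open>\<Omega>\<close>.
\<close>
lemma tendsto_difference_quotient:
  fixes u \<phi> :: "real ^ 'n \<Rightarrow> real"
  assumes f: "continuous_on {0..} f" "f ` {0..} \<subseteq> {0..}" and "0 \<le> K"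
    and K: "\<forall>t\<ge>0. f t \<le> K * (1 + t)"
    and "open \<Omega>" "bounded \<Omega>" and u: "u \<in> dirichlet_space s \<Omega>" and \<phi>: "\<phi> \<in> dirichlet_space s \<Omega>"
  shows "set_integrable lborel \<Omega> (\<lambda>x. f (max 0 (u x)) * \<phi> x)"
    and "(\<lambda>k. LINT x:\<Omega>|lborel. (extended_primitive f (u x + 1 / real (Suc k) * \<phi> x) - extended_primitive f (u x)) * real (Suc k))
       \<longlonglongrightarrow> (LINT x:\<Omega>|lborel. f (max 0 (u x)) * \<phi> x)"
proof -
  note [measurable] = dirichlet_spaceD(1)[OF u] dirichlet_spaceD(1)[OF \<phi>]
  have [measurable]: "\<Omega> \<in> sets borel" using \<open>open \<Omega>\<close> by simp
  define G where "G = extended_primitive f"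
  have Gc: "continuous_on UNIV G" unfolding G_def by (rule continuous_extended_primitive[OF f(1)])
  have [measurable]: "G \<in> borel_measurable borel" using Gc by (rule borel_measurable_continuous_onI)
  have "continuous_on UNIV (\<lambda>x. f (max 0 x))"
    by (rule continuous_on_compose2[OF f(1)]) (auto intro!: continuous_intros)
  then have [measurable]: "(\<lambda>x. f (max 0 x)) \<in> borel_measurable borel" by (rule borel_measurable_continuous_onI)
  have growth: "\<bar>G a - G b\<bar> \<le> K * ((1 + \<bar>b\<bar> + \<bar>a - b\<bar>) * \<bar>a - b\<bar>)" for a b
    unfolding G_def by (rule extended_primitive_growth[OF f \<open>0 \<le> K\<close> K])
  define h where "h k x = indicator \<Omega> x *\<^sub>R ((G (u x + 1 / real (Suc k) * \<phi> x) - G (u x)) * real (Suc k))" for k x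
  define b where "b x = K * (indicator \<Omega> x + (u x)\<^sup>2 + 3 * (\<phi> x)\<^sup>2)" for x
  have fin: "emeasure lborel \<Omega> < \<infinity>" using emeasure_bounded_finite[OF \<open>bounded \<Omega>\<close>] by simp
  have ib: "integrable lborel b"
    unfolding b_def using fin dirichlet_spaceD(3)[OF u] dirichlet_spaceD(3)[OF \<phi>]
    by (intro integrable_mult_right Bochner_Integration.integrable_add integrable_real_indicator) auto
  have hm: "h k \<in> borel_measurable lborel" for k unfolding h_def by measurable
  have lm: "(\<lambda>x. indicator \<Omega> x *\<^sub>R (f (max 0 (u x)) * \<phi> x)) \<in> borel_measurable lborel" by measurable
  have bound: "norm (h k x) \<le> b x" for k x
  proof (cases "x \<in> \<Omega>")
    case True
    define t where "t = 1 / real (Suc k)"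
    have t: "0 < t" "t \<le> 1" by (auto simp: t_def)
    have "\<bar>G (u x + t * \<phi> x) - G (u x)\<bar> \<le> K * ((1 + \<bar>u x\<bar> + \<bar>t * \<phi> x\<bar>) * \<bar>t * \<phi> x\<bar>)"
      using growth[of "u x + t * \<phi> x" "u x"] by simp
    also have "\<dots> = t * (K * ((1 + \<bar>u x\<bar> + t * \<bar>\<phi> x\<bar>) * \<bar>\<phi> x\<bar>))" using t by (simp add: abs_mult)
    finally have "\<bar>G (u x + t * \<phi> x) - G (u x)\<bar> * real (Suc k) \<le>
        t * (K * ((1 + \<bar>u x\<bar> + t * \<bar>\<phi> x\<bar>) * \<bar>\<phi> x\<bar>)) * real (Suc k)"
      by (rule mult_right_mono) simp
    also have "\<dots> = (t * real (Suc k)) * (K * ((1 + \<bar>u x\<bar> + t * \<bar>\<phi> x\<bar>) * \<bar>\<phi> x\<bar>))"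
      by (simp only: mult_ac)
    also have "t * real (Suc k) = 1" by (simp add: t_def)
    also have "1 * (K * ((1 + \<bar>u x\<bar> + t * \<bar>\<phi> x\<bar>) * \<bar>\<phi> x\<bar>)) = K * ((1 + \<bar>u x\<bar> + t * \<bar>\<phi> x\<bar>) * \<bar>\<phi> x\<bar>)"
      by (rule mult_1)
    also have "\<dots> \<le> K * (1 + (u x)\<^sup>2 + 3 * (\<phi> x)\<^sup>2)"
    proof (rule mult_left_mono[OF _ \<open>0 \<le> K\<close>])
      have "0 \<le> (1 - \<bar>\<phi> x\<bar>)\<^sup>2" "0 \<le> (\<bar>u x\<bar> - \<bar>\<phi> x\<bar>)\<^sup>2" by auto
      then have "2 * \<bar>\<phi> x\<bar> \<le> 1 + (\<phi> x)\<^sup>2" "2 * (\<bar>u x\<bar> * \<bar>\<phi> x\<bar>) \<le> (u x)\<^sup>2 + (\<phi> x)\<^sup>2"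
        by (simp_all add: power2_eq_square algebra_simps)
      moreover have "t * (\<phi> x)\<^sup>2 \<le> 1 * (\<phi> x)\<^sup>2" using t by (intro mult_right_mono) auto
      moreover have "(1 + \<bar>u x\<bar> + t * \<bar>\<phi> x\<bar>) * \<bar>\<phi> x\<bar> = \<bar>\<phi> x\<bar> + \<bar>u x\<bar> * \<bar>\<phi> x\<bar> + t * (\<phi> x)\<^sup>2"
        by (simp add: power2_eq_square algebra_simps)
      ultimately show "(1 + \<bar>u x\<bar> + t * \<bar>\<phi> x\<bar>) * \<bar>\<phi> x\<bar> \<le> 1 + (u x)\<^sup>2 + 3 * (\<phi> x)\<^sup>2"
        using zero_le_power2[of "u x"] zero_le_power2[of "\<phi> x"] by linarith
    qed
    finally show ?thesis using True by (simp add: h_def b_def t_def abs_mult)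
  next
    case False
    then show ?thesis using \<open>0 \<le> K\<close> by (simp add: h_def b_def)
  qed
  have lim: "(\<lambda>k. h k x) \<longlonglongrightarrow> indicator \<Omega> x *\<^sub>R (f (max 0 (u x)) * \<phi> x)" for x
  proof -
    have "((\<lambda>y. G (u x + y * \<phi> x)) has_field_derivative f (max 0 (u x)) * \<phi> x) (at 0)"
    proof (rule DERIV_chain'[where g = G])
      show "((\<lambda>y. u x + y * \<phi> x) has_field_derivative \<phi> x) (at 0)" by (auto intro!: derivative_eq_intros)
      show "(G has_field_derivative f (max 0 (u x))) (at (u x + 0 * \<phi> x))"
        unfolding G_def using DERIV_extended_primitive[OF f(1), of "u x"] by simp
    qed
    then have D: "((\<lambda>y. (G (u x + y * \<phi> x) - G (u x)) / y) \<longlongrightarrow> f (max 0 (u x)) * \<phi> x) (at 0)"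
      by (simp add: has_field_derivative_iff)
    have "filterlim (\<lambda>k. 1 / real (Suc k)) (at 0) sequentially"
      unfolding filterlim_at using LIMSEQ_Suc[OF lim_1_over_n] by simp
    from filterlim_compose[OF D this]
    have "(\<lambda>k. (G (u x + 1 / real (Suc k) * \<phi> x) - G (u x)) * real (Suc k)) \<longlonglongrightarrow> f (max 0 (u x)) * \<phi> x" by simp
    then show ?thesis unfolding h_def by (rule tendsto_scaleR[OF tendsto_const])
  qed
  have "integrable lborel (\<lambda>x. indicator \<Omega> x *\<^sub>R (f (max 0 (u x)) * \<phi> x))"
    by (rule integrable_dominated_convergence[where s = h, OF lm hm ib]) (use lim bound in auto)
  then show "set_integrable lborel \<Omega> (\<lambda>x. f (max 0 (u x)) * \<phi> x)" by (simp add: set_integrable_def)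
  have "(\<lambda>k. integral\<^sup>L lborel (h k)) \<longlonglongrightarrow> (LINT x|lborel. indicator \<Omega> x *\<^sub>R (f (max 0 (u x)) * \<phi> x))"
    by (rule integral_dominated_convergence[where s = h, OF lm hm ib]) (use lim bound in auto)
  then show "(\<lambda>k. LINT x:\<Omega>|lborel. (extended_primitive f (u x + 1 / real (Suc k) * \<phi> x) - extended_primitive f (u x)) * real (Suc k))
       \<longlonglongrightarrow> (LINT x:\<Omega>|lborel. f (max 0 (u x)) * \<phi> x)"
    unfolding set_lebesgue_integral_def h_def[abs_def] G_def .
qed

text \<open>
  One-sided difference quotients along \<open>t = 1 / Suc k\<close> at a minimiser give an inequality for every
  direction; applying it to \<open>\<phi>\<close> and to \<open>- \<phi>\<close> gives equality.
\<close>
lemma euler_lagrange: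
  fixes u \<phi> :: "real ^ 'n \<Rightarrow> real"
  assumes f: "continuous_on {0..} f" "f ` {0..} \<subseteq> {0..}" and "0 \<le> K"
    and K: "\<forall>t\<ge>0. f t \<le> K * (1 + t)"
    and "open \<Omega>" "bounded \<Omega>" and u: "u \<in> dirichlet_space s \<Omega>" and \<phi>: "\<phi> \<in> dirichlet_space s \<Omega>"
    and min: "\<And>w. w \<in> dirichlet_space s \<Omega> \<Longrightarrow> euler_functional s \<Omega> \<alpha> f u \<le> euler_functional s \<Omega> \<alpha> f w"
  shows "gagliardo_form s u \<phi> = \<alpha> * (LINT x:\<Omega>|lborel. f (max 0 (u x)) * \<phi> x)"
proof -
  have le: "\<alpha> * (LINT x:\<Omega>|lborel. f (max 0 (u x)) * \<psi> x) \<le> gagliardo_form s u \<psi>"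
    if \<psi>: "\<psi> \<in> dirichlet_space s \<Omega>" for \<psi>
  proof (rule LIMSEQ_le)
    let ?Q = "\<lambda>k. LINT x:\<Omega>|lborel. (extended_primitive f (u x + 1 / real (Suc k) * \<psi> x) - extended_primitive f (u x)) * real (Suc k)"
    show "(\<lambda>k. \<alpha> * ?Q k) \<longlonglongrightarrow> \<alpha> * (LINT x:\<Omega>|lborel. f (max 0 (u x)) * \<psi> x)"
      by (intro tendsto_intros tendsto_difference_quotient(2)[OF f \<open>0 \<le> K\<close> K \<open>open \<Omega>\<close> \<open>bounded \<Omega>\<close> u \<psi>])
    have "(\<lambda>k. gagliardo_form s u \<psi> + 1 / real (Suc k) * (energy s \<psi> / 2)) \<longlonglongrightarrow> gagliardo_form s u \<psi> + 0 * (energy s \<psi> / 2)"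
      by (intro tendsto_intros LIMSEQ_Suc lim_1_over_n)
    then show "(\<lambda>k. gagliardo_form s u \<psi> + 1 / real (Suc k) * (energy s \<psi> / 2)) \<longlonglongrightarrow> gagliardo_form s u \<psi>" by simp
    have "\<alpha> * ?Q k \<le> gagliardo_form s u \<psi> + 1 / real (Suc k) * (energy s \<psi> / 2)" for k
    proof -
      define t where "t = 1 / real (Suc k)"
      have "0 < t" by (simp add: t_def)
      note w = dirichlet_space_add_scaled[OF u \<psi>, of t]
      note si = set_integrable_extended_primitive[OF f \<open>0 \<le> K\<close> K \<open>open \<Omega>\<close> \<open>bounded \<Omega>\<close>]
      have "?Q k = ((LINT x:\<Omega>|lborel. extended_primitive f (u x + t * \<psi> x)) - (LINT x:\<Omega>|lborel. extended_primitive f (u x))) / t"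
        using si[OF w(1)] si[OF u] by (simp add: t_def set_integral_diff)
      then have Q: "t * ?Q k = (LINT x:\<Omega>|lborel. extended_primitive f (u x + t * \<psi> x)) - (LINT x:\<Omega>|lborel. extended_primitive f (u x))"
        using \<open>0 < t\<close> by simp
      have "energy s u / 2 - \<alpha> * (LINT x:\<Omega>|lborel. extended_primitive f (u x)) \<le>
         (energy s u + (2 * t * gagliardo_form s u \<psi> + t\<^sup>2 * energy s \<psi>)) / 2
         - \<alpha> * (LINT x:\<Omega>|lborel. extended_primitive f (u x + t * \<psi> x))"
        using min[OF w(1)] by (simp add: euler_functional_def w(2))
      then have "\<alpha> * (t * ?Q k) \<le> t * gagliardo_form s u \<psi> + t\<^sup>2 * energy s \<psi> / 2"
        unfolding Q by (simp add: algebra_simps)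
      then have "t * (\<alpha> * ?Q k) \<le> t * (gagliardo_form s u \<psi> + t * (energy s \<psi> / 2))"
        by (simp add: power2_eq_square algebra_simps)
      then show ?thesis using \<open>0 < t\<close> unfolding t_def[symmetric] by (simp add: mult_le_cancel_left_pos)
    qed
    then show "\<exists>N. \<forall>k\<ge>N. \<alpha> * ?Q k \<le> gagliardo_form s u \<psi> + 1 / real (Suc k) * (energy s \<psi> / 2)" by blast
  qed
  have "gagliardo_integrand s u (\<lambda>x. - 1 * \<phi> x) = (\<lambda>z. - gagliardo_integrand s u \<phi> z)"
    by (auto simp: gagliardo_integrand_def minus_divide_left algebra_simps)
  then have "gagliardo_form s u (\<lambda>x. - 1 * \<phi> x) = - gagliardo_form s u \<phi>" by (simp add: gagliardo_form_def)
  with le[OF \<phi>] le[OF dirichlet_space_scale[OF \<phi>, of "- 1"]] show ?thesis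
    by (simp add: set_lebesgue_integral_def)
qed

text \<open>
  With \<open>w = t \<bar>\<phi>\<bar>\<close> the lower bound \<open>c w\<^sup>2\<close> for the primitive is available where \<open>w < \<delta>\<close>. For small \<open>t\<close> this
  set carries almost all of \<open>\<integral> \<phi>\<^sup>2\<close>, and the primitive is non-negative elsewhere, so the strict
  inequality between the energy of \<open>\<phi>\<close> and \<open>2 \<alpha> c \<integral> \<phi>\<^sup>2\<close> survives; \<open>\<phi>\<close> may be unbounded.
\<close>
lemma euler_functional_negative:
  fixes \<Omega> :: "(real ^ 'n) set"
  assumes f: "continuous_on {0..} f" "f ` {0..} \<subseteq> {0..}" and "0 \<le> K"
    and K: "\<forall>t\<ge>0. f t \<le> K * (1 + t)"
    and "open \<Omega>" "bounded \<Omega>" and \<phi>: "\<phi> \<in> dirichlet_space s \<Omega>" "0 < (LINT x|lborel. (\<phi> x)\<^sup>2)"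
    and e: "energy s \<phi> < 2 * \<alpha> * c * (LINT x|lborel. (\<phi> x)\<^sup>2)" and "0 < \<alpha>"
    and near0: "0 < \<delta>" "\<And>t. 0 < t \<Longrightarrow> t < \<delta> \<Longrightarrow> c * t\<^sup>2 \<le> primitive f t"
  obtains w where "w \<in> dirichlet_space s \<Omega>" "euler_functional s \<Omega> \<alpha> f w < 0"
proof -
  note [measurable] = dirichlet_spaceD(1)[OF \<phi>(1)]
  have [measurable]: "\<Omega> \<in> sets borel" using \<open>open \<Omega>\<close> by simp
  define I where "I = (LINT x|lborel. (\<phi> x)\<^sup>2)"
  \<comment> \<open>The set where \<open>w < \<delta>\<close> for \<open>t = 1 / Suc k\<close>.\<close>
  define A where "A k = {x. \<bar>\<phi> x\<bar> < \<delta> * real (Suc k)}" for k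
  have [measurable]: "A k \<in> sets borel" for k unfolding A_def by measurable
  have "(\<lambda>k. LINT x|lborel. indicator (A k) x * (\<phi> x)\<^sup>2) \<longlonglongrightarrow> I"
    unfolding I_def
  proof (rule integral_dominated_convergence[where w = "\<lambda>x. (\<phi> x)\<^sup>2"])
    show "integrable lborel (\<lambda>x. (\<phi> x)\<^sup>2)" by (rule dirichlet_spaceD(3)[OF \<phi>(1)])
    show "AE x in lborel. (\<lambda>k. indicator (A k) x * (\<phi> x)\<^sup>2) \<longlonglongrightarrow> (\<phi> x)\<^sup>2"
    proof (intro AE_I2 tendsto_eventually)
      fix x
      obtain N where "\<bar>\<phi> x\<bar> / \<delta> < real N" using reals_Archimedean2 by blast
      then have N: "\<bar>\<phi> x\<bar> < \<delta> * real N" using near0(1) by (simp add: field_simps)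
      show "\<forall>\<^sub>F k in sequentially. indicator (A k) x * (\<phi> x)\<^sup>2 = (\<phi> x)\<^sup>2"
        using eventually_ge_at_top[of N]
      proof eventually_elim
        fix k assume "N \<le> k"
        then have "\<delta> * real N \<le> \<delta> * real (Suc k)" using near0(1) by (intro mult_left_mono) auto
        then have "x \<in> A k" using N by (simp add: A_def)
        then show "indicator (A k) x * (\<phi> x)\<^sup>2 = (\<phi> x)\<^sup>2" by simp
      qed
    qed
  qed (auto simp: indicator_def)
  then have "(\<lambda>k. energy s \<phi> - 2 * \<alpha> * c * (LINT x|lborel. indicator (A k) x * (\<phi> x)\<^sup>2)) \<longlonglongrightarrow> energy s \<phi> - 2 * \<alpha> * c * I"
    by (intro tendsto_intros)
  then have "\<forall>\<^sub>F k in sequentially. energy s \<phi> - 2 * \<alpha> * c * (LINT x|lborel. indicator (A k) x * (\<phi> x)\<^sup>2) < 0"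
    by (rule order_tendstoD(2)) (use e in \<open>simp add: I_def\<close>)
  then obtain k where k: "energy s \<phi> < 2 * \<alpha> * c * (LINT x|lborel. indicator (A k) x * (\<phi> x)\<^sup>2)"
    by (auto simp: eventually_sequentially)
  define t where "t = 1 / real (Suc k)"
  have "0 < t" by (simp add: t_def)
  define w where "w x = t * \<bar>\<phi> x\<bar>" for x
  note a = dirichlet_space_abs[OF \<phi>(1)]
  have w: "w \<in> dirichlet_space s \<Omega>" unfolding w_def[abs_def] by (rule dirichlet_space_scale[OF a(1)])
  have "energy s w = t\<^sup>2 * energy s (\<lambda>x. \<bar>\<phi> x\<bar>)" unfolding w_def[abs_def] by (rule energy_scale)
  also have "\<dots> \<le> t\<^sup>2 * energy s \<phi>" by (intro mult_left_mono a(2)) simp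
  finally have ew: "energy s w \<le> t\<^sup>2 * energy s \<phi>" .
  have iA: "integrable lborel (\<lambda>x. indicator (A k) x * (\<phi> x)\<^sup>2)"
    using integrable_real_mult_indicator[of "A k" lborel "\<lambda>x. (\<phi> x)\<^sup>2"] dirichlet_spaceD(3)[OF \<phi>(1)]
    by (simp add: mult.commute)
  have "c * t\<^sup>2 * (LINT x|lborel. indicator (A k) x * (\<phi> x)\<^sup>2) = (LINT x|lborel. c * t\<^sup>2 * (indicator (A k) x * (\<phi> x)\<^sup>2))"
    by simp
  also have "\<dots> \<le> (LINT x:\<Omega>|lborel. extended_primitive f (w x))"
    unfolding set_lebesgue_integral_def
  proof (rule integral_mono)
    show "integrable lborel (\<lambda>x. c * t\<^sup>2 * (indicator (A k) x * (\<phi> x)\<^sup>2))" using iA by simp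
    show "integrable lborel (\<lambda>x. indicator \<Omega> x *\<^sub>R extended_primitive f (w x))"
      using set_integrable_extended_primitive[OF f \<open>0 \<le> K\<close> K \<open>open \<Omega>\<close> \<open>bounded \<Omega>\<close> w] by (simp add: set_integrable_def)
    fix x
    have w0: "0 \<le> w x" using \<open>0 < t\<close> by (simp add: w_def)
    have p0: "0 \<le> indicator \<Omega> x *\<^sub>R extended_primitive f (w x)"
      using primitive_nonneg[OF f, of "w x"] w0 by (simp add: extended_primitive_nonneg)
    show "c * t\<^sup>2 * (indicator (A k) x * (\<phi> x)\<^sup>2) \<le> indicator \<Omega> x *\<^sub>R extended_primitive f (w x)"
    proof (cases "x \<in> A k \<and> \<phi> x \<noteq> 0")
      case True
      then have "x \<in> \<Omega>" using dirichlet_spaceD(2)[OF \<phi>(1)] by blast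
      have "0 < w x" using True \<open>0 < t\<close> by (simp add: w_def)
      moreover have "w x < \<delta>" using True by (simp add: w_def A_def t_def field_simps)
      ultimately have "c * (w x)\<^sup>2 \<le> primitive f (w x)" by (rule near0(2))
      then show ?thesis using True \<open>x \<in> \<Omega>\<close> w0
        by (simp add: extended_primitive_nonneg w_def power_mult_distrib mult.assoc)
    next
      case False
      then have "c * t\<^sup>2 * (indicator (A k) x * (\<phi> x)\<^sup>2) = 0" by (auto simp: indicator_def)
      with p0 show ?thesis by (simp only:)
    qed
  qed
  finally have "\<alpha> * (c * t\<^sup>2 * (LINT x|lborel. indicator (A k) x * (\<phi> x)\<^sup>2)) \<le> \<alpha> * (LINT x:\<Omega>|lborel. extended_primitive f (w x))"
    using \<open>0 < \<alpha>\<close> by simp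
  moreover have "t\<^sup>2 * energy s \<phi> < t\<^sup>2 * (2 * \<alpha> * c * (LINT x|lborel. indicator (A k) x * (\<phi> x)\<^sup>2))"
    using k \<open>0 < t\<close> by simp
  moreover have "t\<^sup>2 * (2 * \<alpha> * c * (LINT x|lborel. indicator (A k) x * (\<phi> x)\<^sup>2)) =
     2 * (\<alpha> * (c * t\<^sup>2 * (LINT x|lborel. indicator (A k) x * (\<phi> x)\<^sup>2)))" by simp
  ultimately have "euler_functional s \<Omega> \<alpha> f w < 0" using ew unfolding euler_functional_def by linarith
  then show thesis using w that by blast
qed

text \<open>
  Testing with Borel representatives suffices: both sides of the weak equation depend only on the
  class of \<open>\<phi>\<close>, and \<open>f (max 0 (u x)) = f (u x)\<close> as \<open>u \<ge> 0\<close>. The left form is Borel measurable even though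
  \<open>f\<close> is arbitrary on the negative half-line.
\<close>
lemma nonneg_weak_solutionI:
  fixes u :: "real ^ 'n \<Rightarrow> real"
  assumes "open \<Omega>" and u: "u \<in> dirichlet_space s \<Omega>" "\<And>x. 0 \<le> u x"
    and f: "continuous_on {0..} f"
    and sol: "\<And>\<phi>. \<phi> \<in> dirichlet_space s \<Omega> \<Longrightarrow> set_integrable lborel \<Omega> (\<lambda>x. f (max 0 (u x)) * \<phi> x) \<and>
       gagliardo_form s u \<phi> = \<alpha> * (LINT x:\<Omega>|lborel. f (max 0 (u x)) * \<phi> x)"
  shows "nonneg_weak_solution s \<Omega> \<alpha> f u"
  unfolding nonneg_weak_solution_def
proof (intro conjI ballI)
  note [measurable] = dirichlet_spaceD(1)[OF u(1)]
  show "u \<in> X0 s \<Omega>" using u(1) dirichlet_space_subset_X0 by blast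
  show "AE x in lebesgue. 0 \<le> u x" using u(2) by simp
  fix \<phi> assume \<phi>: "\<phi> \<in> X0 s \<Omega>"
  then obtain \<psi> where \<psi>: "\<psi> \<in> dirichlet_space s \<Omega>" "AE x in lborel. \<phi> x = \<psi> x"
    using X0_borel_representative \<open>open \<Omega>\<close> by blast
  note [measurable] = dirichlet_spaceD(1)[OF \<psi>(1)]
  have [measurable]: "\<Omega> \<in> sets borel" using \<open>open \<Omega>\<close> by simp
  have "continuous_on UNIV (\<lambda>x. f (max 0 x))"
    by (rule continuous_on_compose2[OF f]) (auto intro!: continuous_intros)
  then have [measurable]: "(\<lambda>x. f (max 0 x)) \<in> borel_measurable borel" by (rule borel_measurable_continuous_onI)
  have mpsi: "(\<lambda>x. indicator \<Omega> x *\<^sub>R (f (max 0 (u x)) * \<psi> x)) \<in> borel_measurable lborel" by measurable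
  note mpsi' = measurable_completion[OF mpsi]
  have eq: "AE x in lebesgue. indicator \<Omega> x *\<^sub>R (f (max 0 (u x)) * \<psi> x) = indicator \<Omega> x *\<^sub>R (f (u x) * \<phi> x)"
    unfolding AE_completion_iff using \<psi>(2) by eventually_elim (use u(2) in \<open>simp add: max_def\<close>)
  have mphi: "(\<lambda>x. indicator \<Omega> x *\<^sub>R (f (u x) * \<phi> x)) \<in> borel_measurable lebesgue"
    using borel_measurable_AE[OF mpsi' eq] .
  show "set_integrable lebesgue \<Omega> (\<lambda>x. f (u x) * \<phi> x)"
    using sol[OF \<psi>(1)] integrable_cong_AE[OF mpsi' mphi eq] integrable_completion[OF mpsi]
    by (simp add: set_integrable_def)
  have "(LINT x:\<Omega>|lebesgue. f (u x) * \<phi> x) = (LINT x:\<Omega>|lborel. f (max 0 (u x)) * \<psi> x)"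
    using integral_cong_AE[OF mpsi' mphi eq] integral_completion[OF mpsi]
    by (simp add: set_lebesgue_integral_def)
  moreover have "gagliardo_form s u \<phi> = gagliardo_form s u \<psi>"
    by (rule gagliardo_form_cong_AE(1)) (use \<psi>(2) in auto)
  ultimately show "gagliardo_form s u \<phi> = \<alpha> * (LINT x:\<Omega>|lebesgue. f (u x) * \<phi> x)"
    using sol[OF \<psi>(1)] by simp
qed

section \<open>Existence of a non-zero solution\<close>

theorem theorem1p1:
  fixes s q \<alpha> :: real and \<Omega> :: "(real ^ 'n) set" and f :: "real \<Rightarrow> real"
  assumes "0 < s" and "s < 1" and "real CARD('n) > 2 * s"
    and "open \<Omega>" and "bounded \<Omega>" and "\<Omega> \<noteq> {}" and "lipschitz_boundary \<Omega>"
    and "continuous_on {0..} f" and "f ` {0..} \<subseteq> {0..}"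
    and "1 \<le> q" and "q < 2 * real CARD('n) / (real CARD('n) - 2 * s)"
    and "strict_antimono_on {0<..} (\<lambda>t. f t / t powr (q - 1))"
    and "((\<lambda>t. f t / t powr (q - 1)) \<longlongrightarrow> 0) at_top"
    and "((\<lambda>\<xi>. primitive f \<xi> / \<xi>\<^sup>2) \<longlongrightarrow> 0) at_top"
    and "liminf_quotient f > 0"
    and "ereal \<alpha> > ereal (first_eigenvalue s \<Omega>) / (2 * liminf_quotient f)"
  shows "\<exists>u. nonneg_weak_solution s \<Omega> \<alpha> f u \<and> \<not> (AE x in lebesgue. u x = 0)"
proof -
  note f = assms(8,9)
  obtain \<phi> where \<phi>: "\<phi> \<in> dirichlet_space s \<Omega>" "0 < (LINT x|lborel. (\<phi> x)\<^sup>2)"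
    "energy s \<phi> = first_eigenvalue s \<Omega> * (LINT x|lborel. (\<phi> x)\<^sup>2)" "0 \<le> first_eigenvalue s \<Omega>"
    using first_eigenvalue_attained[OF assms(1,2,4,5,6)] by blast
  obtain c \<delta> where c: "0 < \<alpha>" "first_eigenvalue s \<Omega> < 2 * \<alpha> * c" "0 < \<delta>"
    "\<And>t. 0 < t \<Longrightarrow> t < \<delta> \<Longrightarrow> c * t\<^sup>2 \<le> primitive f t"
    using quadratic_lower_bound_near_0[OF assms(15) \<phi>(4) assms(16)] by metis
  obtain K where K: "0 \<le> K" "\<forall>t\<ge>0. f t \<le> K * (1 + t)"
    using linear_growth[OF f assms(10,12,14)] by metis
  obtain u where u: "u \<in> dirichlet_space s \<Omega>" "\<And>x. 0 \<le> u x"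
    "\<And>w. w \<in> dirichlet_space s \<Omega> \<Longrightarrow> euler_functional s \<Omega> \<alpha> f u \<le> euler_functional s \<Omega> \<alpha> f w"
    using euler_functional_minimizer_exists[OF assms(1,4,5) c(1) f K assms(14)] by metis
  have "energy s \<phi> < 2 * \<alpha> * c * (LINT x|lborel. (\<phi> x)\<^sup>2)"
    using \<phi>(2,3) c(2) by simp
  then obtain w where "w \<in> dirichlet_space s \<Omega>" "euler_functional s \<Omega> \<alpha> f w < 0"
    using euler_functional_negative[OF f K assms(4,5) \<phi>(1,2) _ c(1,3,4)] by metis
  then have neg: "euler_functional s \<Omega> \<alpha> f u < 0" using u(3) by fastforce
  have "\<not> (AE x in lebesgue. u x = 0)"
  proof
    assume "AE x in lebesgue. u x = 0"
    then have ae: "AE x in lborel. u x = 0" by (simp add: AE_completion_iff)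
    have "(LINT x:\<Omega>|lborel. extended_primitive f (u x)) = 0"
      unfolding set_lebesgue_integral_def
      by (rule integral_eq_zero_AE) (use ae in eventually_elim, simp add: extended_primitive_nonpos)
    then show False using neg energy_nonneg[of s u] by (simp add: euler_functional_def)
  qed
  moreover have "nonneg_weak_solution s \<Omega> \<alpha> f u"
    using euler_lagrange[OF f K assms(4,5) u(1) _ u(3)]
      tendsto_difference_quotient(1)[OF f K assms(4,5) u(1)]
    by (intro nonneg_weak_solutionI[OF assms(4) u(1,2) f(1)]) auto
  ultimately show ?thesis by blast
qed

end
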